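(* Let $(X,x_0)$ be a compact, admissible pointed (Hausdorff) space and let $n\geq 1$. Then the order complex of the configuration poset ${\rm exp}_n(X)$ has the homotopy type of ${\rm Thom}_n(X\setminus\{x_0\})$: $$\Delta({\rm exp}_n(X))\simeq {\rm Thom}_n(X\setminus\{x_0\}).$$
   Context: A topological poset is a poset $(\mathcal P,\leq)$ with a Hausdorff topology such that $\{(p,q)\mid p\leq q\}$ is closed in $\mathcal P\times\mathcal P$. Its order complex $\Delta(\mathcal P)$ is the geometric realization of the simplicial space $N_*(\mathcal P)$, where $N_k(\mathcal P)\subseteq\mathcal P^{k+1}$ is the subspace of (not necessarily strict) chains $x_0\leq\cdots\leq x_k$, with face maps deleting and degeneracy maps repeating entries; as a set it is the union of geometric simplices spanned by the finite strictly increasing chains of $\mathcal P$, but its topology is induced from that of $\mathcal P$. For a space $X$, ${\rm exp}_n(X)$ is the space of nonempty finite subsets $A\subseteq X$ with $|A|\leq n$, with the Vietoris topology, ordered by inclusion. $F(Y,k)$ is the space of ordered $k$-tuples of pairwise distinct points of $Y$, with the free action of the symmetric group $S_k$, and $B(Y,k)=F(Y,k)/S_k$. Let $V$ be the standard $(n-1)$-dimensional representation of $S_n$ (the permutation representation on $\mathbb R^n$ minus the trivial summand). ${\rm Thom}_n(Y)$ denotes the one-point compactification of the total space $F(Y,n)\times_{S_n}V$ of the vector bundle $\mathbb R^{n-1}\to F(Y,n)\times_{S_n}V\to B(Y,n)$. Let $\mathcal P={\rm exp}_n(X)$, $\hat{\mathcal P}=\mathcal P\cup\{\hat0,\hat1\}$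 (adjoined bottom and top; this is a lattice), $C$ the set of complements of $\{x_0\}$ in $\hat{\mathcal P}$, i.e. elements $A\in\mathcal P$ with $A\wedge\{x_0\}=\hat0$ and $A\vee\{x_0\}=\hat1$, and $\mathcal R=\mathcal P\setminus C$. The pointed space $(X,x_0)$ is called admissible if the inclusion $\Delta(\mathcal R)\hookrightarrow\Delta(\mathcal P)$ is a cofibration. *)

theory Defs
  imports "HOL-Analysis.Analysis" "HOL-Homology.Simplices" "HOL-Combinatorics.Permutations"
begin

section \<open>Quotient spaces\<close>

text \<open>The quotient of a space by the smallest equivalence relation containing \<open>r\<close>
  (a relation between points of the space), with equivalence classes as points.\<close>

definition quotient_class :: "'a topology \<Rightarrow> ('a \<Rightarrow> 'a \<Rightarrow> bool) \<Rightarrow> 'a \<Rightarrow> 'a set" where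
  "quotient_class X r x = {y \<in> topspace X. equivclp r x y}"

definition quotient_topology :: "'a topology \<Rightarrow> ('a \<Rightarrow> 'a \<Rightarrow> bool) \<Rightarrow> 'a set topology" where
  "quotient_topology X r =
     topology (\<lambda>U. U \<subseteq> quotient_class X r ` topspace X \<and>
       openin X {x \<in> topspace X. quotient_class X r x \<in> U})"

lemma istopology_pullback:
  "istopology (\<lambda>U. U \<subseteq> S \<and> openin X {x \<in> topspace X. q x \<in> U})"
  unfolding istopology_def
proof (intro conjI allI impI; (elim conjE)?)
  fix U V
  assume "openin X {x \<in> topspace X. q x \<in> U}" "openin X {x \<in> topspace X. q x \<in> V}"
  then have "openin X ({x \<in> topspace X. q x \<in> U} \<inter> {x \<in> topspace X. q x \<in> V})"
    by blast
  moreover have "{x \<in> topspace X. q x \<in> U} \<inter> {x \<in> topspace X. q x \<in> V}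
      = {x \<in> topspace X. q x \<in> U \<inter> V}"
    by blast
  ultimately show "openin X {x \<in> topspace X. q x \<in> U \<inter> V}"
    by simp
next
  fix K assume K: "\<forall>U\<in>K. U \<subseteq> S \<and> openin X {x \<in> topspace X. q x \<in> U}"
  then have "openin X (\<Union>U\<in>K. {x \<in> topspace X. q x \<in> U})"
    by blast
  moreover have "(\<Union>U\<in>K. {x \<in> topspace X. q x \<in> U}) = {x \<in> topspace X. q x \<in> \<Union>K}"
    by blast
  ultimately show "openin X {x \<in> topspace X. q x \<in> \<Union>K}"
    by simp
qed blast+

lemma openin_quotient_topology:
  "openin (quotient_topology X r) U \<longleftrightarrow>
     U \<subseteq> quotient_class X r ` topspace X \<and>
     openin X {x \<in> topspace X. quotient_class X r x \<in> U}"
  unfolding quotient_topology_def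
  by (simp add: topology_inverse'[OF istopology_pullback])

lemma topspace_quotient_topology:
  "topspace (quotient_topology X r) = quotient_class X r ` topspace X"
proof
  show "topspace (quotient_topology X r) \<subseteq> quotient_class X r ` topspace X"
    using openin_quotient_topology openin_topspace by blast
  have "{x \<in> topspace X. quotient_class X r x \<in> quotient_class X r ` topspace X} = topspace X"
    by blast
  then have "openin (quotient_topology X r) (quotient_class X r ` topspace X)"
    by (simp add: openin_quotient_topology)
  then show "quotient_class X r ` topspace X \<subseteq> topspace (quotient_topology X r)"
    by (rule openin_subset)
qed

lemma quotient_map_quotient_class:
  "quotient_map X (quotient_topology X r) (quotient_class X r)"
  by (simp add: quotient_map_def topspace_quotient_topology openin_quotient_topology)


section \<open>Geometric realization and order complexes\<close>

abbreviation simplex_space :: "nat \<Rightarrow> (nat \<Rightarrow> real) topology" where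
  "simplex_space k \<equiv> subtopology (powertop_real UNIV) (standard_simplex k)"

definition simplicial_degen :: "nat \<Rightarrow> (nat \<Rightarrow> real) \<Rightarrow> nat \<Rightarrow> real" where
  "simplicial_degen i t =
     (\<lambda>j. if j < i then t j else if j = i then t i + t (Suc i) else t (Suc j))"

text \<open>A simplicial space is given by its spaces \<open>N k\<close>, its face maps \<open>d k i : N (k+1) \<rightarrow> N k\<close>
  and its degeneracy maps \<open>s k i : N k \<rightarrow> N (k+1)\<close>. The cosimplicial structure of the standard
  simplices is given by \<^const>\<open>simplical_face\<close> and \<^const>\<open>simplicial_degen\<close>.\<close>

inductive realization_rel ::
  "(nat \<Rightarrow> 'b topology) \<Rightarrow> (nat \<Rightarrow> nat \<Rightarrow> 'b \<Rightarrow> 'b) \<Rightarrow> (nat \<Rightarrow> nat \<Rightarrow> 'b \<Rightarrow> 'b)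
    \<Rightarrow> nat \<times> 'b \<times> (nat \<Rightarrow> real) \<Rightarrow> nat \<times> 'b \<times> (nat \<Rightarrow> real) \<Rightarrow> bool"
  for N d s where
  face: "x \<in> topspace (N (Suc k)) \<Longrightarrow> i \<le> Suc k \<Longrightarrow> t \<in> standard_simplex k
    \<Longrightarrow> realization_rel N d s (k, d k i x, t) (Suc k, x, simplical_face i t)"
| degen: "x \<in> topspace (N k) \<Longrightarrow> i \<le> k \<Longrightarrow> t \<in> standard_simplex (Suc k)
    \<Longrightarrow> realization_rel N d s (Suc k, s k i x, t) (k, x, simplicial_degen i t)"

definition realization_sum ::
  "(nat \<Rightarrow> 'b topology) \<Rightarrow> (nat \<times> 'b \<times> (nat \<Rightarrow> real)) topology" where
  "realization_sum N = sum_topology (\<lambda>k. prod_topology (N k) (simplex_space k)) UNIV"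

definition geometric_realization ::
  "(nat \<Rightarrow> 'b topology) \<Rightarrow> (nat \<Rightarrow> nat \<Rightarrow> 'b \<Rightarrow> 'b) \<Rightarrow> (nat \<Rightarrow> nat \<Rightarrow> 'b \<Rightarrow> 'b)
    \<Rightarrow> (nat \<times> 'b \<times> (nat \<Rightarrow> real)) set topology" where
  "geometric_realization N d s = quotient_topology (realization_sum N) (realization_rel N d s)"

text \<open>A chain of length \<open>k\<close> is a function on \<open>{..k}\<close>, extended by \<^const>\<open>undefined\<close>.\<close>

definition chain_space :: "'p topology \<Rightarrow> ('p \<Rightarrow> 'p \<Rightarrow> bool) \<Rightarrow> nat \<Rightarrow> (nat \<Rightarrow> 'p) topology" where
  "chain_space P leq k =
     subtopology (product_topology (\<lambda>_. P) {..k}) {x. \<forall>i<k. leq (x i) (x (Suc i))}"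

definition chain_face :: "nat \<Rightarrow> nat \<Rightarrow> (nat \<Rightarrow> 'p) \<Rightarrow> nat \<Rightarrow> 'p" where
  "chain_face k i x = (\<lambda>j\<in>{..k}. if j < i then x j else x (Suc j))"

definition chain_degen :: "nat \<Rightarrow> nat \<Rightarrow> (nat \<Rightarrow> 'p) \<Rightarrow> nat \<Rightarrow> 'p" where
  "chain_degen k i x = (\<lambda>j\<in>{..Suc k}. if j \<le> i then x j else x (j - 1))"

definition order_complex ::
  "'p topology \<Rightarrow> ('p \<Rightarrow> 'p \<Rightarrow> bool) \<Rightarrow> (nat \<times> (nat \<Rightarrow> 'p) \<times> (nat \<Rightarrow> real)) set topology" where
  "order_complex P leq = geometric_realization (chain_space P leq) chain_face chain_degen"

text \<open>The map of order complexes induced by the inclusion of a subposet of \<open>P\<close>: it sends the class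
  of \<open>(k, x, t)\<close> in the smaller complex to the class of \<open>(k, x, t)\<close> in the order complex of \<open>P\<close>.\<close>

definition order_complex_inclusion ::
  "'p topology \<Rightarrow> ('p \<Rightarrow> 'p \<Rightarrow> bool) \<Rightarrow> (nat \<times> (nat \<Rightarrow> 'p) \<times> (nat \<Rightarrow> real)) set
    \<Rightarrow> (nat \<times> (nat \<Rightarrow> 'p) \<times> (nat \<Rightarrow> real)) set" where
  "order_complex_inclusion P leq c =
     (\<Union>z\<in>c. quotient_class (realization_sum (chain_space P leq))
                (realization_rel (chain_space P leq) chain_face chain_degen) z)"


section \<open>Cofibrations\<close>

text \<open>The homotopy extension property. Since one cannot quantify over types, the test spaces \<open>Z\<close>
  live on a type large enough to carry the mapping cylinder of \<open>i\<close>; the lemma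
  \<open>cofibration_extension\<close> below gives the extension property for test spaces on any type.\<close>

definition cofibration :: "'a topology \<Rightarrow> 'b topology \<Rightarrow> ('a \<Rightarrow> 'b) \<Rightarrow> bool" where
  "cofibration A X i \<longleftrightarrow>
     continuous_map A X i \<and>
     (\<forall>(Z :: ('a \<times> real + 'b) topology) f h.
        continuous_map X Z f \<and>
        continuous_map (prod_topology A (top_of_set {0..1::real})) Z h \<and>
        (\<forall>a\<in>topspace A. h (a, 0) = f (i a)) \<longrightarrow>
        (\<exists>H. continuous_map (prod_topology X (top_of_set {0..1::real})) Z H \<and>
             (\<forall>x\<in>topspace X. H (x, 0) = f x) \<and>
             (\<forall>a\<in>topspace A. \<forall>s\<in>{0..1}. H (i a, s) = h (a, s))))"

lemma cofibration_extension:
  fixes Z :: "'z topology"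
  assumes cof: "cofibration A X i"
    and f: "continuous_map X Z f"
    and h: "continuous_map (prod_topology A (top_of_set {0..1::real})) Z h"
    and fh: "\<And>a. a \<in> topspace A \<Longrightarrow> h (a, 0) = f (i a)"
  shows "\<exists>H. continuous_map (prod_topology X (top_of_set {0..1::real})) Z H \<and>
             (\<forall>x\<in>topspace X. H (x, 0) = f x) \<and>
             (\<forall>a\<in>topspace A. \<forall>s\<in>{0..1}. H (i a, s) = h (a, s))"
proof -
  let ?AI = "prod_topology A (top_of_set {0..1::real})"
  let ?XI = "prod_topology X (top_of_set {0..1::real})"
  have i: "continuous_map A X i"
    using cof by (simp add: cofibration_def)
  then have iX: "i a \<in> topspace X" if "a \<in> topspace A" for a
    using that by (auto simp: continuous_map_def)
  define jA where "jA = (\<lambda>p. if snd p = (0::real) then Inr (i (fst p)) else Inl p)"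
  define M where "M = Inl ` topspace ?AI \<union> Inr ` topspace X"
  define op where "op = (\<lambda>U. (U \<subseteq> M \<and> openin X {x \<in> topspace X. Inr x \<in> U}) \<and>
                             (U \<subseteq> M \<and> openin ?AI {p \<in> topspace ?AI. jA p \<in> U}))"
  define T where "T = topology op"
  have "istopology op"
    using istopology_pullback[of M X Inr] istopology_pullback[of M ?AI jA]
    unfolding istopology_def op_def by simp
  then have opT: "openin T U \<longleftrightarrow> op U" for U
    by (simp add: T_def topology_inverse')
  have jA_M: "jA p \<in> M" if "p \<in> topspace ?AI" for p
    using that iX by (auto simp: jA_def M_def)
  have "op M"
  proof -
    have "{x \<in> topspace X. Inr x \<in> M} = topspace X"
      by (auto simp: M_def)
    moreover have "{p \<in> topspace ?AI. jA p \<in> M} = topspace ?AI"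
      using jA_M by blast
    ultimately show ?thesis
      unfolding op_def by (metis openin_topspace order_refl)
  qed
  then have topT: "topspace T = M"
    by (metis opT op_def openin_subset openin_topspace subset_antisym)
  have cX: "continuous_map X T Inr"
    unfolding continuous_map by (auto simp: topT opT op_def M_def)
  have cA: "continuous_map ?AI T jA"
    unfolding continuous_map using jA_M by (auto simp: topT opT op_def)
  have "\<forall>a\<in>topspace A. jA (a, 0) = Inr (i a)"
    by (simp add: jA_def)
  then obtain R where R: "continuous_map ?XI T R"
    and R0: "\<And>x. x \<in> topspace X \<Longrightarrow> R (x, 0) = Inr x"
    and RA: "\<And>a s. a \<in> topspace A \<Longrightarrow> s \<in> {0..1} \<Longrightarrow> R (i a, s) = jA (a, s)"
    using cof[unfolded cofibration_def, THEN conjunct2, rule_format, of T Inr jA] cX cA by blast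
  define g where "g = case_sum h f"
  have gA: "g (jA p) = h p" if "p \<in> topspace ?AI" for p
    using that fh by (cases p) (auto simp: g_def jA_def)
  have gX: "g (Inr x) = f x" for x
    by (simp add: g_def)
  have "continuous_map T Z g"
    unfolding continuous_map
  proof (intro conjI allI impI)
    show "g ` topspace T \<subseteq> topspace Z"
      using continuous_map_image_subset_topspace[OF f] continuous_map_image_subset_topspace[OF h]
      by (auto simp: topT M_def g_def simp del: topspace_prod_topology)
    fix U assume U: "openin Z U"
    have "{x \<in> topspace X. Inr x \<in> {m \<in> topspace T. g m \<in> U}} = {x \<in> topspace X. f x \<in> U}"
      by (auto simp: topT M_def gX)
    moreover have "{p \<in> topspace ?AI. jA p \<in> {m \<in> topspace T. g m \<in> U}}
        = {p \<in> topspace ?AI. h p \<in> U}"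
      using gA jA_M by (auto simp: topT simp del: topspace_prod_topology)
    ultimately show "openin T {m \<in> topspace T. g m \<in> U}"
      unfolding opT op_def using openin_continuous_map_preimage[OF f U] openin_continuous_map_preimage[OF h U]
      by (auto simp: topT simp del: topspace_prod_topology)
  qed
  then have "continuous_map ?XI Z (g \<circ> R)"
    by (rule continuous_map_compose[OF R])
  then show ?thesis
    by (intro exI[of _ "g \<circ> R"]) (auto simp: R0 RA gX gA)
qed


section \<open>Configuration posets and admissible pointed spaces\<close>

definition vietoris_topology :: "'a topology \<Rightarrow> 'a set set \<Rightarrow> 'a set topology" where
  "vietoris_topology X \<A> =
     subtopology
       (topology_generated_by
         ({{A. A \<subseteq> U} | U. openin X U} \<union> {{A. A \<inter> U \<noteq> {}} | U. openin X U})) \<A>"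

definition exp_space :: "nat \<Rightarrow> 'a topology \<Rightarrow> 'a set topology" where
  "exp_space n X =
     vietoris_topology X {A. A \<subseteq> topspace X \<and> finite A \<and> A \<noteq> {} \<and> card A \<le> n}"

lemma topspace_exp_space:
  "topspace (exp_space n X) = {A. A \<subseteq> topspace X \<and> finite A \<and> A \<noteq> {} \<and> card A \<le> n}"
proof -
  have "{A. A \<subseteq> topspace X} \<in> {{A. A \<subseteq> U} | U. openin X U}"
    by blast
  then show ?thesis
    unfolding exp_space_def vietoris_topology_def topspace_subtopology
      topology_generated_by_topspace by blast
qed

datatype 'p hat = Zero_hat | In_hat 'p | One_hat

fun hat_le :: "('p \<Rightarrow> 'p \<Rightarrow> bool) \<Rightarrow> 'p hat \<Rightarrow> 'p hat \<Rightarrow> bool" where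
  "hat_le leq Zero_hat b = True"
| "hat_le leq (In_hat p) Zero_hat = False"
| "hat_le leq (In_hat p) (In_hat q) = leq p q"
| "hat_le leq (In_hat p) One_hat = True"
| "hat_le leq One_hat b = (b = One_hat)"

definition hat_order :: "'p set \<Rightarrow> ('p \<Rightarrow> 'p \<Rightarrow> bool) \<Rightarrow> 'p hat gorder" where
  "hat_order P leq =
     \<lparr>carrier = {Zero_hat, One_hat} \<union> In_hat ` P, eq = (=), le = hat_le leq\<rparr>"

lemma hat_order_simps [simp]:
  "carrier (hat_order P leq) = {Zero_hat, One_hat} \<union> In_hat ` P"
  "eq (hat_order P leq) = (=)"
  "le (hat_order P leq) = hat_le leq"
  by (simp_all add: hat_order_def)

lemma partial_order_hat_subset: "partial_order (hat_order P (\<subseteq>))"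
proof (unfold_locales, goal_cases)
  case (5 x y) then show ?case by (cases x; cases y) simp_all
next
  case (6 x y z) then show ?case by (cases x; cases y; cases z) simp_all
next
  case (4 x) then show ?case by (cases x) simp_all
qed simp_all

lemma least_hat_upper:
  "least (hat_order P leq) s (Upper (hat_order P leq) {x, y}) \<longleftrightarrow>
     s \<in> carrier (hat_order P leq) \<and> hat_le leq x s \<and> hat_le leq y s \<and>
     (\<forall>z\<in>carrier (hat_order P leq). hat_le leq x z \<longrightarrow> hat_le leq y z \<longrightarrow> hat_le leq s z)"
  if "x \<in> carrier (hat_order P leq)" "y \<in> carrier (hat_order P leq)"
  using that unfolding least_def Upper_def hat_order_simps by blast

lemma greatest_hat_lower:
  "greatest (hat_order P leq) s (Lower (hat_order P leq) {x, y}) \<longleftrightarrow>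
     s \<in> carrier (hat_order P leq) \<and> hat_le leq s x \<and> hat_le leq s y \<and>
     (\<forall>z\<in>carrier (hat_order P leq). hat_le leq z x \<longrightarrow> hat_le leq z y \<longrightarrow> hat_le leq z s)"
  if "x \<in> carrier (hat_order P leq)" "y \<in> carrier (hat_order P leq)"
  using that unfolding greatest_def Lower_def hat_order_simps by blast

lemma hat_le_refl: "hat_le (\<subseteq>) x x"
  by (cases x) simp_all

lemma hat_le_One: "hat_le leq x One_hat"
  by (cases x) simp_all

lemma lattice_hat_exp_space: "lattice (hat_order (topspace (exp_space n X)) (\<subseteq>))"
  (is "lattice ?L")
proof -
  let ?P = "topspace (exp_space n X)"
  have sub: "B \<in> ?P" if B: "B \<subseteq> A" "B \<noteq> {}" and A: "A \<in> ?P" for A B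
  proof -
    have "finite A" "A \<subseteq> topspace X" "card A \<le> n"
      using A by (simp_all add: topspace_exp_space)
    moreover have "finite B"
      using B(1) \<open>finite A\<close> by (rule finite_subset)
    moreover have "card B \<le> card A"
      using \<open>finite A\<close> B(1) by (rule card_mono)
    ultimately show ?thesis
      using B unfolding topspace_exp_space by simp
  qed
  have lub: "\<exists>s. least ?L s (Upper ?L {x, y})" if xy: "x \<in> carrier ?L" "y \<in> carrier ?L" for x y
  proof -
    have "\<exists>s\<in>carrier ?L. hat_le (\<subseteq>) x s \<and> hat_le (\<subseteq>) y s \<and>
      (\<forall>z\<in>carrier ?L. hat_le (\<subseteq>) x z \<longrightarrow> hat_le (\<subseteq>) y z \<longrightarrow> hat_le (\<subseteq>) s z)"
    proof (cases x)
      case Zero_hat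
      with xy show ?thesis by (intro bexI[of _ y]) (simp_all add: hat_le_refl)
    next
      case One_hat
      with xy show ?thesis by (intro bexI[of _ x]) (simp_all add: hat_le_One)
    next
      case A: (In_hat A)
      show ?thesis
      proof (cases y)
        case Zero_hat
        with xy show ?thesis by (intro bexI[of _ x]) (simp_all add: hat_le_refl)
      next
        case One_hat
        with xy show ?thesis by (intro bexI[of _ y]) (simp_all add: hat_le_One)
      next
        case B: (In_hat B)
        have AP: "A \<in> ?P" using xy A by auto
        show ?thesis
        proof (cases "A \<union> B \<in> ?P")
          case True
          show ?thesis
          proof (intro bexI[of _ "In_hat (A \<union> B)"] conjI ballI impI)
            fix z assume "hat_le (\<subseteq>) x z" "hat_le (\<subseteq>) y z"
            with A B show "hat_le (\<subseteq>) (In_hat (A \<union> B)) z" by (cases z) simp_all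
          qed (use A B True in simp_all)
        next
          case False
          show ?thesis
          proof (intro bexI[of _ One_hat] conjI ballI impI)
            fix z assume z: "z \<in> carrier ?L" "hat_le (\<subseteq>) x z" "hat_le (\<subseteq>) y z"
            show "hat_le (\<subseteq>) One_hat z"
            proof (cases z)
              case Zero_hat
              with z(2) A show ?thesis by simp
            next
              case (In_hat D)
              have "A \<subseteq> D" "B \<subseteq> D" using z(2,3) unfolding In_hat A B by simp_all
              moreover have "D \<in> ?P" using z(1) unfolding In_hat by auto
              moreover have "A \<union> B \<noteq> {}" using AP by (simp add: topspace_exp_space)
              ultimately have "A \<union> B \<in> ?P" using sub[of "A \<union> B" D] by blast
              with False show ?thesis by blast
            qed simp
          qed (simp_all add: hat_le_One)
        qed
      qed
    qed
    then show ?thesis by (simp only: least_hat_upper[OF xy] Bex_def)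
  qed
  have glb: "\<exists>s. greatest ?L s (Lower ?L {x, y})" if xy: "x \<in> carrier ?L" "y \<in> carrier ?L" for x y
  proof -
    have "\<exists>s\<in>carrier ?L. hat_le (\<subseteq>) s x \<and> hat_le (\<subseteq>) s y \<and>
      (\<forall>z\<in>carrier ?L. hat_le (\<subseteq>) z x \<longrightarrow> hat_le (\<subseteq>) z y \<longrightarrow> hat_le (\<subseteq>) z s)"
    proof (cases x)
      case One_hat
      with xy show ?thesis by (intro bexI[of _ y]) (simp_all add: hat_le_refl hat_le_One)
    next
      case Zero_hat
      with xy show ?thesis by (intro bexI[of _ x]) simp_all
    next
      case A: (In_hat A)
      show ?thesis
      proof (cases y)
        case One_hat
        with xy show ?thesis by (intro bexI[of _ x]) (simp_all add: hat_le_refl hat_le_One)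
      next
        case Zero_hat
        with xy show ?thesis by (intro bexI[of _ y]) simp_all
      next
        case B: (In_hat B)
        have AP: "A \<in> ?P" using xy A by auto
        show ?thesis
        proof (cases "A \<inter> B = {}")
          case True
          show ?thesis
          proof (intro bexI[of _ Zero_hat] conjI ballI impI)
            fix z assume z: "z \<in> carrier ?L" "hat_le (\<subseteq>) z x" "hat_le (\<subseteq>) z y"
            show "hat_le (\<subseteq>) z Zero_hat"
            proof (cases z)
              case One_hat
              with z(2) A show ?thesis by simp
            next
              case (In_hat D)
              have "D \<subseteq> A" "D \<subseteq> B" using z(2,3) unfolding In_hat A B by simp_all
              moreover have "D \<noteq> {}" using z(1) unfolding In_hat by (auto simp: topspace_exp_space)
              ultimately show ?thesis using True by blast
            qed simp
          qed simp_all
        next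
          case False
          then have "A \<inter> B \<in> ?P" using sub[OF Int_lower1 _ AP] by simp
          show ?thesis
          proof (intro bexI[of _ "In_hat (A \<inter> B)"] conjI ballI impI)
            fix z assume "hat_le (\<subseteq>) z x" "hat_le (\<subseteq>) z y"
            with A B show "hat_le (\<subseteq>) z (In_hat (A \<inter> B))" by (cases z) simp_all
          qed (use A B \<open>A \<inter> B \<in> ?P\<close> in simp_all)
        qed
      qed
    qed
    then show ?thesis by (simp only: greatest_hat_lower[OF xy] Bex_def)
  qed
  show ?thesis
    by (intro lattice.intro upper_semilattice.intro upper_semilattice_axioms.intro
        lower_semilattice.intro lower_semilattice_axioms.intro partial_order_hat_subset lub glb)
qed

definition complements :: "('b, 'm) gorder_scheme \<Rightarrow> 'b \<Rightarrow> 'b set" where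
  "complements L b =
     {a \<in> carrier L. a \<sqinter>\<^bsub>L\<^esub> b = \<bottom>\<^bsub>L\<^esub> \<and> a \<squnion>\<^bsub>L\<^esub> b = \<top>\<^bsub>L\<^esub>}"

definition exp_complements :: "nat \<Rightarrow> 'a topology \<Rightarrow> 'a \<Rightarrow> 'a set set" where
  "exp_complements n X x0 =
     {A \<in> topspace (exp_space n X).
        In_hat A \<in> complements (hat_order (topspace (exp_space n X)) (\<subseteq>)) (In_hat {x0})}"

definition admissible :: "nat \<Rightarrow> 'a topology \<Rightarrow> 'a \<Rightarrow> bool" where
  "admissible n X x0 \<longleftrightarrow>
     (let P = exp_space n X;
          R = subtopology P (topspace P - exp_complements n X x0)
      in cofibration (order_complex R (\<subseteq>)) (order_complex P (\<subseteq>))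
           (order_complex_inclusion P (\<subseteq>)))"


section \<open>Configuration spaces and Thom spaces\<close>

definition configuration_space :: "'a topology \<Rightarrow> nat \<Rightarrow> (nat \<Rightarrow> 'a) topology" where
  "configuration_space Y k =
     subtopology (product_topology (\<lambda>_. Y) {..<k}) {x. inj_on x {..<k}}"

text \<open>The standard representation is realized as the sum-zero hyperplane in \<open>\<real>\<^sup>n\<close>.\<close>

definition standard_rep :: "nat \<Rightarrow> (nat \<Rightarrow> real) topology" where
  "standard_rep n = subtopology (powertop_real {..<n}) {v. (\<Sum>i<n. v i) = 0}"

text \<open>The orbit relation of the symmetric group, which permutes the entries of the configuration
  and the coordinates of the vector simultaneously.\<close>

definition thom_rel ::
  "nat \<Rightarrow> (nat \<Rightarrow> 'a) \<times> (nat \<Rightarrow> real) \<Rightarrow> (nat \<Rightarrow> 'a) \<times> (nat \<Rightarrow> real) \<Rightarrow> bool" where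
  "thom_rel n p q \<longleftrightarrow>
     (\<exists>\<pi>. \<pi> permutes {..<n} \<and> fst q = fst p \<circ> \<pi> \<and> snd q = snd p \<circ> \<pi>)"

definition thom_bundle :: "nat \<Rightarrow> 'a topology \<Rightarrow> ((nat \<Rightarrow> 'a) \<times> (nat \<Rightarrow> real)) set topology" where
  "thom_bundle n Y =
     quotient_topology (prod_topology (configuration_space Y n) (standard_rep n)) (thom_rel n)"

definition thom_space ::
  "nat \<Rightarrow> 'a topology \<Rightarrow> ((nat \<Rightarrow> 'a) \<times> (nat \<Rightarrow> real)) set option topology" where
  "thom_space n Y = Alexandroff_compactification (thom_bundle n Y)"

end

theory Submission
  imports Defs
begin

text \<open>A point of the order complex of \<open>exp\<^sub>n(X)\<close>, given by a chain \<open>A\<^sub>0 \<subseteq> \<dots> \<subseteq> A\<^sub>k\<close> with barycentric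
  coordinates \<open>t\<close>, is determined by the function \<open>f a = (\<Sum>i | a \<in> A\<^sub>i. t\<^sub>i)\<close>, a fuzzy set with maximal
  value 1 and at most \<open>n\<close> support points: the chain consists of the superlevel sets of \<open>f\<close>. This
  identifies the order complex with a compact Hausdorff space of fuzzy sets. A point lies in
  \<open>\<Delta>(\<R>)\<close> iff the support of \<open>f\<close> contains \<open>x0\<close> or has less than \<open>n\<close> points, and \<open>\<Delta>(\<R>)\<close> is
  contracted by raising the value at \<open>x0\<close> to 1 and then lowering all the other values to 0. Outside
  of \<open>\<Delta>(\<R>)\<close>, taking logarithms of the \<open>n\<close> positive values of \<open>f\<close> modulo constants yields a point of
  the bundle \<open>F(Y, n) \<times>\<^sub>S V\<close> with \<open>Y = X - {x0}\<close>. Hence the quotient of the order complex by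
  \<open>\<Delta>(\<R>)\<close> is the Thom space, and the collapse of the contractible subspace \<open>\<Delta>(\<R>)\<close>, whose inclusion
  is a cofibration, is a homotopy equivalence.\<close>


section \<open>Collapsing a contractible subspace\<close>

text \<open>A realization is a quotient of an infinite sum, so neither compactness nor the Hausdorff
  property can be read off, while the collapse and its product with the interval have to be quotient
  maps. Fuzzy sets settle both: test functions separate them, and one compact cell, \<open>n\<close>
  points of \<open>X\<close> times the simplex of dimension \<open>n - 1\<close>, reaches every
  point of the complex. After that most quotient claims are instances of one fact, that a continuous
  surjection from a compact onto a Hausdorff space is a quotient map. Logarithms modulo constants
  fit the representation because the values of \<open>f\<close> have maximum 1: they are
  \<open>n\<close> positive numbers up to scale, and real vectors modulo constants are equivariantly
  the sum-zero hyperplane. Leaving the stratum means that a value tends to 0, two points merge or a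
  point reaches \<open>x0\<close>, and each of these is going to infinity in the bundle. The
  contraction is confined to the subcomplex because adjoining \<open>x0\<close> to \<open>n\<close>
  other points would break the bound on the support.\<close>

lemma homotopic_with_swapI:
  assumes H: "continuous_map (prod_topology X (top_of_set {0..1::real})) Y H"
    and "\<And>x. x \<in> topspace X \<Longrightarrow> H (x, 0) = f x" "\<And>x. x \<in> topspace X \<Longrightarrow> H (x, 1) = g x"
  shows "homotopic_with (\<lambda>x. True) X Y f g"
proof -
  let ?s = "\<lambda>u. (snd u, fst u)"
  have "continuous_map (prod_topology (top_of_set {0..1::real}) X)
      (prod_topology X (top_of_set {0..1::real})) ?s"
    by (intro continuous_map_pairedI continuous_map_fst continuous_map_snd)
  then have "continuous_map (prod_topology (top_of_set {0..1::real}) X) Y (H \<circ> ?s)"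
    using H by (rule continuous_map_compose)
  moreover have "\<forall>x\<in>topspace X. (H \<circ> ?s) (0, x) = f x" "\<forall>x\<in>topspace X. (H \<circ> ?s) (1, x) = g x"
    using assms(2,3) by simp_all
  ultimately show ?thesis
    by (subst homotopic_with) blast+
qed

text \<open>The cofibration extends \<open>h\<close> to a homotopy \<open>H\<close> of the identity
  of \<open>D\<close>. Its end map is constant on the image of \<open>i\<close> and factors through
  \<open>q\<close> as \<open>g\<close>, so \<open>H\<close> joins \<open>id\<close> to
  \<open>g \<circ> q\<close>. Every stage of \<open>q \<circ> H\<close> collapses the image of
  \<open>i\<close>, so it descends to a homotopy from \<open>id\<close> to
  \<open>q \<circ> g\<close>. The values of \<open>h\<close> lie in \<open>D\<close> and stay in the
  image of \<open>i\<close> as a set; the topology of \<open>A\<close> enters only through its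
  source.\<close>

lemma collapse_homotopy_equivalent:
  fixes D :: "'b topology" and Q :: "'c topology"
  assumes cof: "cofibration A D i"
    and D: "compact_space D" and Q: "Hausdorff_space Q"
    and q: "continuous_map D Q q" and surj: "q ` topspace D = topspace Q"
    and inj: "\<And>x y. x \<in> topspace D \<Longrightarrow> y \<in> topspace D \<Longrightarrow> q x = q y \<Longrightarrow>
      x = y \<or> (x \<in> i ` topspace A \<and> y \<in> i ` topspace A)"
    and const: "\<And>a b. a \<in> topspace A \<Longrightarrow> b \<in> topspace A \<Longrightarrow> q (i a) = q (i b)"
    and h: "continuous_map (prod_topology A (top_of_set {0..1::real})) D h"
    and h0: "\<And>a. a \<in> topspace A \<Longrightarrow> h (a, 0) = i a"
    and h1: "\<And>a. a \<in> topspace A \<Longrightarrow> h (a, 1) = c"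
    and hi: "\<And>a s. a \<in> topspace A \<Longrightarrow> s \<in> {0..1} \<Longrightarrow> h (a, s) \<in> i ` topspace A"
  shows "D homotopy_equivalent_space Q"
proof -
  let ?I = "top_of_set {0..1::real}"
  obtain H where H: "continuous_map (prod_topology D ?I) D H"
    and H0: "\<And>x. x \<in> topspace D \<Longrightarrow> H (x, 0) = x"
    and Hi: "\<And>a s. a \<in> topspace A \<Longrightarrow> s \<in> {0..1} \<Longrightarrow> H (i a, s) = h (a, s)"
    using cofibration_extension[OF cof continuous_map_id h] h0 by auto
  have quot: "quotient_map D Q q"
    using q D Q surj by (rule continuous_imp_quotient_map)
  have slice: "continuous_map D D (\<lambda>x. H (x, 1))"
    using continuous_map_compose[OF _ H, of D "\<lambda>x. (x, 1)"]
    by (simp add: o_def continuous_map_pairwise)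
  \<comment> \<open>Distinct points with equal image under \<open>q\<close> both come from
    \<open>A\<close>, where \<open>H\<close> ends at \<open>c\<close>.\<close>
  have "H (x, 1) = H (y, 1)" if "x \<in> topspace D" "y \<in> topspace D" "q x = q y" for x y
    using inj[OF that] Hi h1 by auto
  then obtain g where g: "continuous_map Q D g"
    and gq: "\<And>x. x \<in> topspace D \<Longrightarrow> g (q x) = H (x, 1)"
    using quotient_map_lift_exists[OF quot slice] by metis
  have gD: "homotopic_with (\<lambda>x. True) D D id (g \<circ> q)"
    by (rule homotopic_with_swapI[OF H]) (simp_all add: H0 gq)
  \<comment> \<open>A homotopy on \<open>Q\<close> is defined by descent along \<open>q\<close>
    times the interval, so this product must be a quotient map as well.\<close>
  have prodq: "quotient_map (prod_topology D ?I) (prod_topology Q ?I) (\<lambda>(x, s). (q x, s))"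
  proof (rule continuous_imp_quotient_map)
    show "continuous_map (prod_topology D ?I) (prod_topology Q ?I) (\<lambda>(x, s). (q x, s))"
      using q by (simp add: continuous_map_prod_top)
    show "compact_space (prod_topology D ?I)"
      using D by (simp add: compact_space_prod_topology compact_space_subtopology)
    show "Hausdorff_space (prod_topology Q ?I)"
      using Q by (simp add: Hausdorff_space_prod_topology Hausdorff_space_subtopology)
    show "(\<lambda>(x, s). (q x, s)) ` topspace (prod_topology D ?I) = topspace (prod_topology Q ?I)"
      using surj by (force simp: image_iff)
  qed
  have "continuous_map (prod_topology D ?I) Q (q \<circ> H)"
    using H q by (rule continuous_map_compose)
  moreover have "(q \<circ> H) u = (q \<circ> H) v"
    if uv: "u \<in> topspace (prod_topology D ?I)" "v \<in> topspace (prod_topology D ?I)"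
      "(\<lambda>(x, s). (q x, s)) u = (\<lambda>(x, s). (q x, s)) v" for u v
  proof -
    obtain x y s where xy: "u = (x, s)" "v = (y, s)" "x \<in> topspace D" "y \<in> topspace D" "s \<in> {0..1}"
      "q x = q y"
      using uv by auto
    \<comment> \<open>At time \<open>s\<close> the image of \<open>i\<close> is still carried into
      itself, and \<open>q\<close> is constant there.\<close>
    have "q (H (i a, s)) = q (H (i b, s))" if ab: "a \<in> topspace A" "b \<in> topspace A" for a b
    proof -
      obtain a' b' where "a' \<in> topspace A" "h (a, s) = i a'" "b' \<in> topspace A" "h (b, s) = i b'"
        using hi[OF ab(1) xy(5)] hi[OF ab(2) xy(5)] by blast
      then show ?thesis
        using const[of a' b'] Hi ab xy(5) by simp
    qed
    then show ?thesis
      using inj[OF xy(3,4,6)] xy(1,2) by auto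
  qed
  ultimately obtain K where K: "continuous_map (prod_topology Q ?I) Q K"
    and Kq: "\<And>u. u \<in> topspace (prod_topology D ?I) \<Longrightarrow> K ((\<lambda>(x, s). (q x, s)) u) = (q \<circ> H) u"
    using quotient_map_lift_exists[OF prodq] by metis
  have gQ: "homotopic_with (\<lambda>x. True) Q Q id (q \<circ> g)"
  proof (rule homotopic_with_swapI[OF K])
    fix y assume "y \<in> topspace Q"
    then obtain x where "x \<in> topspace D" "y = q x"
      using surj by blast
    then show "K (y, 0) = id y" "K (y, 1) = (q \<circ> g) y"
      using Kq[of "(x, 0)"] Kq[of "(x, 1)"] by (simp_all add: H0 gq)
  qed
  show ?thesis
    unfolding homotopy_equivalent_space_def
  proof (intro exI conjI)
    show "homotopic_with (\<lambda>x. True) D D (g \<circ> q) id" "homotopic_with (\<lambda>x. True) Q Q (q \<circ> g) id"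
      using gD gQ by (simp_all add: homotopic_with_sym)
  qed (fact q g)+
qed

text \<open>A neighbourhood of infinity is the complement of a compact set. Pulled back by the
  homeomorphism this set is compact in \<open>Z\<close>, hence closed as \<open>Z\<close> is
  Hausdorff, so the preimage is open also at points outside \<open>W\<close>.\<close>

lemma continuous_map_to_Alexandroff:
  assumes Z: "Hausdorff_space Z" and W: "openin Z W"
    and p: "homeomorphic_map (subtopology Z W) B p"
  shows "continuous_map Z (Alexandroff_compactification B) (\<lambda>z. if z \<in> W then Some (p z) else None)"
    (is "continuous_map _ _ ?f")
  unfolding continuous_map
proof (intro conjI allI impI)
  have pW: "p ` W = topspace B"
    using homeomorphic_imp_surjective_map[OF p] openin_subset[OF W] by (simp add: inf.absorb2)
  then show "?f ` topspace Z \<subseteq> topspace (Alexandroff_compactification B)"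
    by auto
  fix V assume "openin (Alexandroff_compactification B) V"
  then consider U where "openin B U" "V = Some ` U"
    | C where "compactin B C" "V = insert None (Some ` (topspace B - C))"
    unfolding openin_Alexandroff_compactification by blast
  then show "openin Z {z \<in> topspace Z. ?f z \<in> V}"
  proof cases
    case 1
    have "openin (subtopology Z W) {z \<in> topspace (subtopology Z W). p z \<in> U}"
      using homeomorphic_imp_continuous_map[OF p] 1(1) openin_continuous_map_preimage by blast
    moreover have "{z \<in> topspace (subtopology Z W). p z \<in> U} = {z \<in> topspace Z. ?f z \<in> V}"
      by (auto simp: 1(2))
    ultimately have "openin (subtopology Z W) {z \<in> topspace Z. ?f z \<in> V}"
      by (simp only:)
    then show ?thesis
      by (rule openin_trans_full[OF _ W])
  next
    case 2
    let ?K = "{z \<in> W. p z \<in> C}"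
    have "p ` ?K = C"
      using pW compactin_subset_topspace[OF 2(1)] by auto
    then have "compactin (subtopology Z W) ?K"
      using homeomorphic_map_compactness[OF p, of ?K] 2(1) openin_subset[OF W] by auto
    then have "closedin Z ?K"
      using Z compactin_imp_closedin compactin_subtopology by blast
    moreover have "topspace Z - ?K = {z \<in> topspace Z. ?f z \<in> V}"
      using pW by (auto simp: 2(2))
    ultimately show ?thesis
      by (metis closedin_def)
  qed
qed

text \<open>Separating points from infinity takes local compactness, which \<open>B\<close> inherits
  from an open subset of a compact Hausdorff space.\<close>

lemma Hausdorff_Alexandroff_open_subset:
  assumes "compact_space Z" "Hausdorff_space Z" "openin Z W"
    and p: "homeomorphic_map (subtopology Z W) B p"
  shows "Hausdorff_space (Alexandroff_compactification B)"
proof -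
  have "subtopology Z W homeomorphic_space B"
    using p by (rule homeomorphic_map_imp_homeomorphic_space)
  moreover have "locally_compact_space (subtopology Z W)"
    using assms by (simp add: compact_imp_locally_compact_space locally_compact_space_open_subset)
  ultimately show ?thesis
    using assms Hausdorff_space_Alexandroff_compactification Hausdorff_space_subtopology
      homeomorphic_Hausdorff_space homeomorphic_locally_compact_space by blast
qed


section \<open>Spaces of fuzzy sets\<close>

text \<open>An integral of \<open>\<phi>\<close> against \<open>f\<close> with sums replaced by
  maxima. The range over the whole type is finite for finitely supported \<open>f\<close>, since all
  points off the support contribute the single value 0.\<close>

definition fuzzy_max :: "('a \<Rightarrow> real) \<Rightarrow> ('a \<Rightarrow> real) \<Rightarrow> real" where
  "fuzzy_max f \<phi> = Max (range (\<lambda>a. f a * \<phi> a))"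

definition fuzzy_sets :: "nat \<Rightarrow> 'a topology \<Rightarrow> ('a \<Rightarrow> real) set" where
  "fuzzy_sets n X = {f. (\<forall>a. 0 \<le> f a \<and> f a \<le> 1) \<and> (\<exists>a. f a = 1) \<and>
     {a. f a \<noteq> 0} \<in> topspace (exp_space n X)}"

text \<open>Multiplication by a nonnegative number commutes with maxima, which lets
  \<open>fuzzy_max\<close> respect pointwise maxima of fuzzy sets. The sign outside the space is
  free because fuzzy sets vanish there.\<close>

definition test_functions :: "'a topology \<Rightarrow> ('a \<Rightarrow> real) set" where
  "test_functions X = {\<phi>. continuous_map X euclideanreal \<phi> \<and> (\<forall>a\<in>topspace X. 0 \<le> \<phi> a)}"

text \<open>The topology is the coarsest one that makes all the functions
  \<open>f \<mapsto> max\<^sub>a f a * \<phi> a\<close> continuous. Their advantage is that the contraction and the cell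
  parametrisation below only take maxima and products of values of \<open>f\<close>, so that continuity is
  immediate and no case distinction on the order of these values is needed.\<close>

definition fuzzy_space :: "nat \<Rightarrow> 'a topology \<Rightarrow> ('a \<Rightarrow> real) topology" where
  "fuzzy_space n X = pullback_topology (fuzzy_sets n X)
     (\<lambda>f \<phi>. if \<phi> \<in> test_functions X then fuzzy_max f \<phi> else 0) (powertop_real UNIV)"

lemma topspace_fuzzy_space [simp]: "topspace (fuzzy_space n X) = fuzzy_sets n X"
  by (simp add: fuzzy_space_def topspace_pullback_topology)

lemma fuzzy_setsD:
  assumes "f \<in> fuzzy_sets n X"
  shows "0 \<le> f a" "f a \<le> 1" "finite {a. f a \<noteq> 0}" "{a. f a \<noteq> 0} \<subseteq> topspace X"
    "card {a. f a \<noteq> 0} \<le> n" "\<exists>a. f a = 1" "a \<notin> topspace X \<Longrightarrow> f a = 0"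
  using assms by (auto simp: fuzzy_sets_def topspace_exp_space)

lemma fuzzy_max_eqI:
  assumes "finite {a. f a \<noteq> 0}" "\<And>a. f a * \<phi> a \<le> m" "f b * \<phi> b = m"
  shows "fuzzy_max f \<phi> = m"
proof -
  have "range (\<lambda>a. f a * \<phi> a) \<subseteq> insert 0 ((\<lambda>a. f a * \<phi> a) ` {a. f a \<noteq> 0})"
    by auto
  then have "finite (range (\<lambda>a. f a * \<phi> a))"
    using assms(1) finite_subset by blast
  then show ?thesis
    unfolding fuzzy_max_def using assms(2,3) by (intro Max_eqI) auto
qed

lemma fuzzy_max_attained:
  assumes "finite {a. f a \<noteq> 0}"
  obtains b where "fuzzy_max f \<phi> = f b * \<phi> b" "\<And>a. f a * \<phi> a \<le> f b * \<phi> b"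
proof -
  have "range (\<lambda>a. f a * \<phi> a) \<subseteq> insert 0 ((\<lambda>a. f a * \<phi> a) ` {a. f a \<noteq> 0})"
    by auto
  then have fin: "finite (range (\<lambda>a. f a * \<phi> a))"
    using assms finite_subset by blast
  then have "Max (range (\<lambda>a. f a * \<phi> a)) \<in> range (\<lambda>a. f a * \<phi> a)"
    by (intro Max_in) auto
  then obtain b where "fuzzy_max f \<phi> = f b * \<phi> b"
    unfolding fuzzy_max_def by blast
  moreover have "f a * \<phi> a \<le> fuzzy_max f \<phi>" for a
    unfolding fuzzy_max_def using fin by (intro Max_ge) auto
  ultimately show thesis
    using that by metis
qed

lemma continuous_map_fuzzy_max:
  assumes "\<phi> \<in> test_functions X"
  shows "continuous_map (fuzzy_space n X) euclideanreal (\<lambda>f. fuzzy_max f \<phi>)"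
proof -
  have "continuous_map (powertop_real UNIV) euclideanreal (\<lambda>x. x \<phi>)"
    by (rule continuous_map_product_projection) simp
  then have "continuous_map (fuzzy_space n X) euclideanreal
      ((\<lambda>x. x \<phi>) \<circ> (\<lambda>f \<phi>. if \<phi> \<in> test_functions X then fuzzy_max f \<phi> else 0))"
    unfolding fuzzy_space_def by (rule continuous_map_pullback)
  then show ?thesis
    using assms by (simp add: o_def)
qed

lemma continuous_map_into_fuzzy_space:
  assumes "\<And>z. z \<in> topspace Z \<Longrightarrow> F z \<in> fuzzy_sets n X"
    and "\<And>\<phi>. \<phi> \<in> test_functions X \<Longrightarrow> continuous_map Z euclideanreal (\<lambda>z. fuzzy_max (F z) \<phi>)"
  shows "continuous_map Z (fuzzy_space n X) F"
  unfolding fuzzy_space_def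
proof (rule continuous_map_pullback')
  have "continuous_map Z euclideanreal
      (\<lambda>z. if \<phi> \<in> test_functions X then fuzzy_max (F z) \<phi> else 0)" for \<phi>
    using assms(2)[of \<phi>] by (cases "\<phi> \<in> test_functions X") auto
  then show "continuous_map Z (powertop_real UNIV)
      ((\<lambda>f \<phi>. if \<phi> \<in> test_functions X then fuzzy_max f \<phi> else 0) \<circ> F)"
    by (simp add: continuous_map_componentwise_UNIV o_def)
  show "topspace Z \<subseteq> F -` fuzzy_sets n X"
    using assms(1) by blast
qed

section \<open>Separation of fuzzy sets by test functions\<close>

lemma test_function_separating:
  assumes "compact_space X" "Hausdorff_space X" "a \<in> topspace X" "finite S" "S \<subseteq> topspace X" "a \<notin> S"
  obtains \<phi> where "\<phi> \<in> test_functions X" "\<phi> a = 1" "\<And>b. b \<in> S \<Longrightarrow> \<phi> b = 0"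
proof -
  have "normal_space X"
    using assms(1,2) by (simp add: compact_Hausdorff_or_regular_imp_normal_space)
  moreover have "closedin X S"
    using assms Hausdorff_imp_t1_space t1_space_closedin_finite by blast
  moreover have "closedin X {a}"
    using assms(2,3) by (rule closedin_Hausdorff_singleton)
  moreover have "disjnt S {a}"
    using assms(6) by simp
  ultimately obtain \<phi> where "continuous_map X (top_of_set {0..1::real}) \<phi>" "\<phi> ` S \<subseteq> {0}" "\<phi> ` {a} \<subseteq> {1}"
    unfolding normal_space_iff_Urysohn by metis
  then show thesis
    by (intro that[of \<phi>]) (auto simp: test_functions_def continuous_map_in_subtopology Pi_iff)
qed

text \<open>Pairing with a test function that is 1 at \<open>a\<close> and 0 at the other support
  points of \<open>f\<close> and \<open>g\<close> reads off both values at \<open>a\<close>, so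
  evaluation embeds the fuzzy sets injectively in a Hausdorff product.\<close>

lemma Hausdorff_fuzzy_space:
  assumes X: "compact_space X" "Hausdorff_space X"
  shows "Hausdorff_space (fuzzy_space n X)"
proof (rule Hausdorff_space_injective_preimage)
  let ?E = "\<lambda>f \<phi>. if \<phi> \<in> test_functions X then fuzzy_max f \<phi> else 0"
  show "Hausdorff_space (powertop_real (UNIV :: ('a \<Rightarrow> real) set))"
    by (simp add: Hausdorff_space_product_topology)
  show "continuous_map (fuzzy_space n X) (powertop_real UNIV) ?E"
    by (simp add: continuous_map_componentwise_UNIV continuous_map_fuzzy_max cong: if_cong)
  show "inj_on ?E (topspace (fuzzy_space n X))"
  proof (rule inj_onI, rule ext)
    fix f g a
    assume fg: "f \<in> topspace (fuzzy_space n X)" "g \<in> topspace (fuzzy_space n X)" and eq: "?E f = ?E g"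
    then have f: "f \<in> fuzzy_sets n X" and g: "g \<in> fuzzy_sets n X"
      by simp_all
    show "f a = g a"
    proof (cases "a \<in> topspace X")
      case False
      then show ?thesis
        using fuzzy_setsD(7)[OF f] fuzzy_setsD(7)[OF g] by simp
    next
      case True
      let ?S = "({b. f b \<noteq> 0} \<union> {b. g b \<noteq> 0}) - {a}"
      obtain \<phi> where \<phi>: "\<phi> \<in> test_functions X" "\<phi> a = 1" and 0: "\<And>b. b \<in> ?S \<Longrightarrow> \<phi> b = 0"
      proof (rule test_function_separating[OF X True, of ?S])
        show "finite ?S" "?S \<subseteq> topspace X" "a \<notin> ?S"
          using fuzzy_setsD[OF f] fuzzy_setsD[OF g] by auto
      qed auto
      have "h b * \<phi> b \<le> h a" if "h = f \<or> h = g" for h b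
        using that 0[of b] \<phi>(2) fuzzy_setsD(1)[OF f, of a] fuzzy_setsD(1)[OF g, of a]
        by (cases "b = a"; cases "h b = 0") auto
      then have "fuzzy_max f \<phi> = f a" "fuzzy_max g \<phi> = g a"
        using \<phi>(2) fuzzy_setsD(3)[OF f] fuzzy_setsD(3)[OF g] by (auto intro!: fuzzy_max_eqI[of _ _ _ a])
      then show ?thesis
        using fun_cong[OF eq, of \<phi>] \<phi>(1) by simp
    qed
  qed
qed

text \<open>The fuzzy set \<open>max (p * f) (r * 1\<^bsub>{x0}\<^esub>)\<close>. The contraction first raises \<open>r\<close> from 0 to 1 while
  \<open>p = 1\<close> and then lowers \<open>p\<close> from 1 to 0 while \<open>r = 1\<close>; in this way the maximal value stays 1.\<close>

definition fuzzy_cone :: "'a \<Rightarrow> real \<Rightarrow> real \<Rightarrow> ('a \<Rightarrow> real) \<Rightarrow> 'a \<Rightarrow> real" where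
  "fuzzy_cone x0 p r f a = (if a = x0 then max (p * f a) r else p * f a)"

text \<open>As \<open>\<phi>\<close> is nonnegative, the maximum in the cone can be pulled through
  the product. The formula carries the continuity of the contraction: only products and one maximum
  of continuous quantities occur in it.\<close>

lemma fuzzy_max_fuzzy_cone:
  assumes f: "f \<in> fuzzy_sets n X" and p: "0 \<le> p" and r: "0 \<le> r" and x0: "x0 \<in> topspace X"
    and \<phi>: "\<phi> \<in> test_functions X"
  shows "fuzzy_max (fuzzy_cone x0 p r f) \<phi> = max (p * fuzzy_max f \<phi>) (r * \<phi> x0)"
proof -
  have \<phi>0: "0 \<le> \<phi> x0"
    using \<phi> x0 by (simp add: test_functions_def)
  obtain b where b: "fuzzy_max f \<phi> = f b * \<phi> b" "\<And>a. f a * \<phi> a \<le> f b * \<phi> b"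
    using fuzzy_max_attained[OF fuzzy_setsD(3)[OF f]] by blast
  have val: "fuzzy_cone x0 p r f a * \<phi> a =
      (if a = x0 then max (p * (f a * \<phi> a)) (r * \<phi> x0) else p * (f a * \<phi> a))" for a
    using \<phi>0 by (simp add: fuzzy_cone_def max_mult_distrib_right mult.assoc)
  have "{a. fuzzy_cone x0 p r f a \<noteq> 0} \<subseteq> insert x0 {a. f a \<noteq> 0}"
    by (auto simp: fuzzy_cone_def split: if_splits)
  then have fin: "finite {a. fuzzy_cone x0 p r f a \<noteq> 0}"
    using fuzzy_setsD(3)[OF f] finite_subset by (metis finite_insert)
  have le: "p * (f a * \<phi> a) \<le> p * (f b * \<phi> b)" for a
    using b(2) p by (rule mult_left_mono)
  have up: "fuzzy_cone x0 p r f a * \<phi> a \<le> max (p * (f b * \<phi> b)) (r * \<phi> x0)" for a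
    unfolding val using le[of a] by (auto simp: max_def)
  show ?thesis
    unfolding b(1)
  \<comment> \<open>The maximum is attained at \<open>x0\<close> if the right-hand term dominates,
    otherwise at a maximiser \<open>b\<close> of the product of \<open>f\<close> and
    \<open>\<phi>\<close>.\<close>
  proof (cases "p * (f b * \<phi> b) \<le> r * \<phi> x0")
    case True
    then show "fuzzy_max (fuzzy_cone x0 p r f) \<phi> = max (p * (f b * \<phi> b)) (r * \<phi> x0)"
      using le[of x0] by (intro fuzzy_max_eqI[OF fin up, of x0]) (simp add: val max_def)
  next
    case False
    then show "fuzzy_max (fuzzy_cone x0 p r f) \<phi> = max (p * (f b * \<phi> b)) (r * \<phi> x0)"
      by (intro fuzzy_max_eqI[OF fin up, of b]) (auto simp: val max_def)
  qed
qed

text \<open>By \<open>pr\<close> the maximal value stays 1: either \<open>x0\<close> receives it or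
  a point of value 1 is left alone. By \<open>L\<close> adjoining \<open>x0\<close> leaves at most
  \<open>n\<close> support points. Once \<open>r\<close> is positive, \<open>x0\<close> is in the
  support, and for \<open>r = 0\<close> nothing has changed, so the condition \<open>L\<close>
  persists.\<close>

lemma fuzzy_cone_in_fuzzy_sets:
  assumes f: "f \<in> fuzzy_sets n X" and x0: "x0 \<in> topspace X" and n: "n \<ge> 1"
    and p: "0 \<le> p" "p \<le> 1" and r: "0 \<le> r" "r \<le> 1" and pr: "p = 1 \<or> r = 1"
    and L: "x0 \<in> {a. f a \<noteq> 0} \<or> card {a. f a \<noteq> 0} < n"
  shows "fuzzy_cone x0 p r f \<in> fuzzy_sets n X"
    and "x0 \<in> {a. fuzzy_cone x0 p r f a \<noteq> 0} \<or> card {a. fuzzy_cone x0 p r f a \<noteq> 0} < n"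
proof -
  let ?g = "fuzzy_cone x0 p r f"
  have pf: "0 \<le> p * f a" "p * f a \<le> 1" for a
    using p fuzzy_setsD(1,2)[OF f, of a] by (simp_all add: mult_le_one)
  have 1: "0 \<le> ?g a \<and> ?g a \<le> 1" for a
    using pf[of a] r by (auto simp: fuzzy_cone_def max_def)
  obtain b where b: "f b = 1"
    using fuzzy_setsD(6)[OF f] by blast
  have ex: "\<exists>a. ?g a = 1"
  proof (cases "r = 1")
    case True
    then have "?g x0 = 1"
      using pf[of x0] by (simp add: fuzzy_cone_def)
    then show ?thesis ..
  next
    case False
    then have "?g b = 1"
      using b pr r by (auto simp: fuzzy_cone_def max_def)
    then show ?thesis ..
  qed
  have sup: "{a. ?g a \<noteq> 0} \<subseteq> insert x0 {a. f a \<noteq> 0}"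
    by (auto simp: fuzzy_cone_def split: if_splits)
  moreover have fin: "finite (insert x0 {a. f a \<noteq> 0})"
    using fuzzy_setsD(3)[OF f] by simp
  ultimately have "card {a. ?g a \<noteq> 0} \<le> card (insert x0 {a. f a \<noteq> 0})" "finite {a. ?g a \<noteq> 0}"
    by (auto intro: card_mono finite_subset)
  moreover have "card (insert x0 {a. f a \<noteq> 0}) \<le> n"
    using L fuzzy_setsD(3,5)[OF f] by (auto simp: card_insert_if)
  moreover have "{a. ?g a \<noteq> 0} \<subseteq> topspace X"
    using sup x0 fuzzy_setsD(4)[OF f] by blast
  moreover have "{a. ?g a \<noteq> 0} \<noteq> {}"
    using ex by force
  ultimately show "?g \<in> fuzzy_sets n X"
    using 1 ex by (simp add: fuzzy_sets_def topspace_exp_space)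
  show "x0 \<in> {a. ?g a \<noteq> 0} \<or> card {a. ?g a \<noteq> 0} < n"
  proof (cases "r = 0")
    case True
    then have "?g = f"
      using pr fuzzy_setsD(1)[OF f] by (auto simp: fuzzy_cone_def fun_eq_iff)
    then show ?thesis using L by simp
  next
    case False
    then have "?g x0 > 0"
      using r by (simp add: fuzzy_cone_def less_max_iff_disj)
    then show ?thesis by simp
  qed
qed

text \<open>Clipping the coefficients gives one formula for both stages: up to time 1/2 only
  \<open>r\<close> moves, afterwards only \<open>p\<close>, and at each time one of them is
  1.\<close>

definition cone_homotopy :: "'a \<Rightarrow> ('a \<Rightarrow> real) \<times> real \<Rightarrow> 'a \<Rightarrow> real" where
  "cone_homotopy x0 z = fuzzy_cone x0 (min 1 (2 - 2 * snd z)) (min 1 (2 * snd z)) (fst z)"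

lemma cone_homotopy_0: "f \<in> fuzzy_sets n X \<Longrightarrow> cone_homotopy x0 (f, 0) = f"
  by (simp add: cone_homotopy_def fuzzy_cone_def fun_eq_iff fuzzy_setsD(1) max_absorb1)

lemma cone_homotopy_1: "cone_homotopy x0 (f, 1) = (\<lambda>a. if a = x0 then 1 else 0)"
  by (simp add: cone_homotopy_def fuzzy_cone_def fun_eq_iff)

lemma cone_homotopy_in_fuzzy_sets:
  assumes "f \<in> fuzzy_sets n X" "x0 \<in> topspace X" "n \<ge> 1"
    and "x0 \<in> {a. f a \<noteq> 0} \<or> card {a. f a \<noteq> 0} < n" and "s \<in> {0..1}"
  shows "cone_homotopy x0 (f, s) \<in> fuzzy_sets n X"
    and "x0 \<in> {a. cone_homotopy x0 (f, s) a \<noteq> 0} \<or> card {a. cone_homotopy x0 (f, s) a \<noteq> 0} < n"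
  unfolding cone_homotopy_def fst_conv snd_conv
  by (rule fuzzy_cone_in_fuzzy_sets; use assms in \<open>auto simp: min_def\<close>)+

lemma continuous_map_cone_homotopy:
  assumes x0: "x0 \<in> topspace X" and n: "n \<ge> 1"
    and L: "\<And>f. f \<in> L \<Longrightarrow> x0 \<in> {a. f a \<noteq> 0} \<or> card {a. f a \<noteq> 0} < n"
  shows "continuous_map (prod_topology (subtopology (fuzzy_space n X) L) (top_of_set {0..1}))
    (fuzzy_space n X) (cone_homotopy x0)" (is "continuous_map ?Z _ _")
proof (rule continuous_map_into_fuzzy_space)
  fix z assume "z \<in> topspace ?Z"
  then have "fst z \<in> fuzzy_sets n X" "fst z \<in> L" "snd z \<in> {0..1}"
    by auto
  then show "cone_homotopy x0 z \<in> fuzzy_sets n X"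
    using cone_homotopy_in_fuzzy_sets(1)[OF _ x0 n L, of "fst z" "snd z"] by simp
next
  fix \<phi> assume \<phi>: "\<phi> \<in> test_functions X"
  have "continuous_map ?Z euclideanreal ((\<lambda>f. fuzzy_max f \<phi>) \<circ> fst)"
    using continuous_map_fst continuous_map_from_subtopology[OF continuous_map_fuzzy_max[OF \<phi>]]
    by (rule continuous_map_compose)
  then have 1: "continuous_map ?Z euclideanreal (\<lambda>z. fuzzy_max (fst z) \<phi>)"
    by (simp add: o_def)
  have 2: "continuous_map ?Z euclideanreal snd"
    using continuous_map_snd continuous_map_into_fulltopology by blast
  have "continuous_map ?Z euclideanreal
      (\<lambda>z. max (min 1 (2 - 2 * snd z) * fuzzy_max (fst z) \<phi>) (min 1 (2 * snd z) * \<phi> x0))"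
    by (intro continuous_map_real_max continuous_map_real_mult continuous_map_real_min
        continuous_map_diff 1 2 continuous_map_const[THEN iffD2]) auto
  moreover have "max (min 1 (2 - 2 * snd z) * fuzzy_max (fst z) \<phi>) (min 1 (2 * snd z) * \<phi> x0) =
      fuzzy_max (cone_homotopy x0 z) \<phi>" if "z \<in> topspace ?Z" for z
  proof -
    have "fst z \<in> fuzzy_sets n X" "0 \<le> min 1 (2 - 2 * snd z)" "0 \<le> min 1 (2 * snd z)"
      using that by auto
    from fuzzy_max_fuzzy_cone[OF this x0 \<phi>] show ?thesis
      by (simp add: cone_homotopy_def)
  qed
  ultimately show "continuous_map ?Z euclideanreal (\<lambda>z. fuzzy_max (cone_homotopy x0 z) \<phi>)"
    by (rule continuous_map_eq)
qed


section \<open>Weight functions of chains\<close>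

definition chain_weight :: "nat \<times> (nat \<Rightarrow> 'a set) \<times> (nat \<Rightarrow> real) \<Rightarrow> 'a \<Rightarrow> real" where
  "chain_weight = (\<lambda>(k, A, t) a. \<Sum>i\<le>k. of_bool (a \<in> A i) * t i)"

text \<open>Duality between pushing \<open>t\<close> forward and pulling \<open>g\<close> back along
  a face map. A membership indicator as \<open>g\<close> gives invariance of weights, the constant 1
  gives the total mass.\<close>

lemma sum_simplical_face:
  fixes g t :: "nat \<Rightarrow> real"
  assumes "i \<le> Suc k"
  shows "(\<Sum>j\<le>Suc k. g j * simplical_face i t j) = (\<Sum>j\<le>k. g (if j < i then j else Suc j) * t j)"
  using assms
proof (induction k)
  case 0
  then have "i = 0 \<or> i = 1" by auto
  then show ?case by (auto simp: simplical_face_def)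
next
  case (Suc k)
  show ?case
  proof (cases "i = Suc (Suc k)")
    case True
    then show ?thesis by (simp add: simplical_face_def)
  next
    case False
    then show ?thesis
      using Suc by (subst sum.atMost_Suc) (simp add: simplical_face_def)
  qed
qed

text \<open>The same duality for a degeneracy: the two coordinates that are merged share one value
  of \<open>g\<close>.\<close>

lemma sum_simplicial_degen:
  fixes g t :: "nat \<Rightarrow> real"
  assumes "i \<le> k"
  shows "(\<Sum>j\<le>k. g j * simplicial_degen i t j) = (\<Sum>j\<le>Suc k. g (if j \<le> i then j else j - 1) * t j)"
  using assms
proof (induction k)
  case 0
  then show ?case by (simp add: simplicial_degen_def distrib_left)
next
  case (Suc k)
  show ?case
  proof (cases "i = Suc k")
    case True
    then show ?thesis by (simp add: simplicial_degen_def distrib_left)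
  next
    case False
    then show ?thesis
      using Suc by (subst sum.atMost_Suc) (simp add: simplicial_degen_def)
  qed
qed

lemma chain_weight_realization_rel:
  assumes "realization_rel N chain_face chain_degen z z'"
  shows "chain_weight z = chain_weight z'"
  using assms
proof cases
  case (face x k i t)
  have "(\<Sum>j\<le>k. of_bool (a \<in> chain_face k i x j) * t j) =
      (\<Sum>j\<le>Suc k. of_bool (a \<in> x j) * simplical_face i t j)" for a
    unfolding sum_simplical_face[OF face(4), of "\<lambda>j. of_bool (a \<in> x j)" t]
    by (rule sum.cong) (auto simp: chain_face_def)
  then show ?thesis
    by (simp add: face chain_weight_def fun_eq_iff del: sum.atMost_Suc)
next
  case (degen x k i t)
  have "(\<Sum>j\<le>Suc k. of_bool (a \<in> chain_degen k i x j) * t j) =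
      (\<Sum>j\<le>k. of_bool (a \<in> x j) * simplicial_degen i t j)" for a
    unfolding sum_simplicial_degen[OF degen(4), of "\<lambda>j. of_bool (a \<in> x j)" t]
    by (rule sum.cong) (auto simp: chain_degen_def)
  then show ?thesis
    by (simp add: degen chain_weight_def fun_eq_iff del: sum.atMost_Suc)
qed

lemma chain_weight_equivclp:
  assumes "equivclp (realization_rel N chain_face chain_degen) z z'"
  shows "chain_weight z = chain_weight z'"
  using assms
  by (induction rule: equivclp_induct) (auto dest: chain_weight_realization_rel)

lemma topspace_chain_space:
  "x \<in> topspace (chain_space P leq k) \<longleftrightarrow>
     x \<in> {..k} \<rightarrow>\<^sub>E topspace P \<and> (\<forall>i<k. leq (x i) (x (Suc i)))"
  by (auto simp: chain_space_def topspace_product_topology)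

lemma topspace_realization_sum:
  "(k, x, t) \<in> topspace (realization_sum N) \<longleftrightarrow> x \<in> topspace (N k) \<and> t \<in> standard_simplex k"
  by (auto simp: realization_sum_def)

lemma chain_mono:
  fixes A :: "nat \<Rightarrow> 'a set"
  assumes "\<forall>i<k. A i \<subseteq> A (Suc i)" "i \<le> j" "j \<le> k"
  shows "A i \<subseteq> A j"
  using assms(2,3)
proof (induction j rule: dec_induct)
  case (step j)
  then show ?case using assms(1) by (metis Suc_le_lessD Suc_leD order_trans)
qed simp

text \<open>A point that enters the chain at \<open>i\<close> belongs to all later members, so its
  weight is a tail sum of \<open>t\<close>.\<close>

lemma chain_weight_first:
  assumes A: "\<forall>i<k. A i \<subseteq> A (Suc i)" and i: "i \<le> k" and a: "a \<in> A i" "\<And>j. j < i \<Longrightarrow> a \<notin> A j"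
  shows "chain_weight (k, A, t) a = sum t {i..k}"
proof -
  have "of_bool (a \<in> A j) * t j = (if j \<in> {i..k} then t j else 0)" if "j \<le> k" for j
    using chain_mono[OF A, of i j] a that by (auto simp: not_le)
  then have "chain_weight (k, A, t) a = (\<Sum>j\<le>k. if j \<in> {i..k} then t j else 0)"
    unfolding chain_weight_def prod.case by (intro sum.cong) auto
  also have "\<dots> = sum t ({..k} \<inter> {i..k})"
    by (subst sum.inter_restrict) simp_all
  also have "{..k} \<inter> {i..k} = {i..k}"
    by auto
  finally show ?thesis .
qed

lemma chain_weight_outside:
  assumes A: "\<forall>i<k. A i \<subseteq> A (Suc i)" and a: "a \<notin> A k"
  shows "chain_weight (k, A, t) a = 0"
  using chain_mono[OF A, of _ k] a by (auto simp: chain_weight_def intro!: sum.neutral)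

lemma chain_weight_ge_tail:
  assumes A: "\<forall>i<k. A i \<subseteq> A (Suc i)" and i: "i \<le> k" and a: "a \<in> A i"
    and t: "\<And>j. j \<le> k \<Longrightarrow> 0 \<le> t j"
  shows "sum t {i..k} \<le> chain_weight (k, A, t) a"
proof -
  have "sum t {i..k} = (\<Sum>j\<in>{i..k}. of_bool (a \<in> A j) * t j)"
    using chain_mono[OF A, of i] a by (intro sum.cong) auto
  also have "\<dots> \<le> chain_weight (k, A, t) a"
    unfolding chain_weight_def prod.case using t by (intro sum_mono2) auto
  finally show ?thesis .
qed

section \<open>Nondegenerate representatives and their uniqueness\<close>

definition nondegenerate :: "nat \<times> (nat \<Rightarrow> 'a set) \<times> (nat \<Rightarrow> real) \<Rightarrow> bool" where
  "nondegenerate = (\<lambda>(k, A, t). (\<forall>i\<le>k. t i > 0) \<and> (\<forall>i<k. A i \<subset> A (Suc i)))"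

lemma chain_face_in_chain_space:
  assumes x: "x \<in> topspace (chain_space P (\<subseteq>) (Suc k))" and i: "i \<le> Suc k"
  shows "chain_face k i x \<in> topspace (chain_space P (\<subseteq>) k)"
  unfolding topspace_chain_space
proof
  have P: "x j \<in> topspace P" if "j \<le> Suc k" for j
    using x that by (auto simp: topspace_chain_space)
  have mono: "\<forall>i<Suc k. x i \<subseteq> x (Suc i)"
    using x by (auto simp: topspace_chain_space)
  show "chain_face k i x \<in> {..k} \<rightarrow>\<^sub>E topspace P"
    using P by (auto simp: chain_face_def)
  show "\<forall>j<k. chain_face k i x j \<subseteq> chain_face k i x (Suc j)"
    unfolding chain_face_def using chain_mono[OF mono] by simp
qed

text \<open>A vanishing coordinate is removed by a face relation, a repeated set by a degeneracy
  relation. Each move shortens the chain by one and stays in the class.\<close>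

lemma nondegenerate_representative:
  assumes "(k, A, t) \<in> topspace (realization_sum (chain_space P (\<subseteq>)))"
  shows "\<exists>z \<in> topspace (realization_sum (chain_space P (\<subseteq>))). nondegenerate z \<and>
    equivclp (realization_rel (chain_space P (\<subseteq>)) chain_face chain_degen) (k, A, t) z"
  using assms
proof (induction k arbitrary: A t)
  case 0
  then have "nondegenerate (0, A, t)"
    by (simp add: nondegenerate_def topspace_realization_sum standard_simplex_def)
  then show ?case
    using 0 by (intro bexI[of _ "(0, A, t)"]) auto
next
  case (Suc k)
  let ?N = "chain_space P (\<subseteq>)"
  let ?R = "realization_rel ?N chain_face chain_degen"
  have A: "A \<in> topspace (?N (Suc k))" and t: "t \<in> standard_simplex (Suc k)"
    using Suc.prems by (simp_all add: topspace_realization_sum)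
  have t0: "0 \<le> t j" "t j \<le> 1" and t_out: "j > Suc k \<Longrightarrow> t j = 0" and t1: "sum t {..Suc k} = 1" for j
    using t unfolding standard_simplex_def by blast+
  have step: ?case if "(k, A', t') \<in> topspace (realization_sum ?N)" "equivclp ?R (Suc k, A, t) (k, A', t')" for A' t'
    using Suc.IH[OF that(1)] that(2) by (meson equivclp_trans)
  consider (nd) "nondegenerate (Suc k, A, t)" | (zero) i where "i \<le> Suc k" "t i = 0"
    | (eq) i where "i \<le> k" "A i = A (Suc i)"
  proof (cases "nondegenerate (Suc k, A, t)")
    case False
    then obtain i where "i \<le> Suc k \<and> t i = 0 \<or> i < Suc k \<and> A i = A (Suc i)"
      using t0(1) A by (force simp: nondegenerate_def topspace_chain_space less_le)
    then show thesis using that by (auto simp: less_Suc_eq_le)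
  qed (use that in blast)
  then show ?case
  proof cases
    case nd
    then show ?thesis using Suc.prems by (intro bexI[of _ "(Suc k, A, t)"]) auto
  next
    case (zero i)
    let ?t = "\<lambda>j. if j < i then t j else t (Suc j)"
    \<comment> \<open>Deleting slot \<open>i\<close> and inserting a zero there restores
      \<open>t\<close>, because \<open>t i = 0\<close>.\<close>
    have eq: "simplical_face i ?t = t"
      using zero by (auto simp: simplical_face_def fun_eq_iff)
    have "sum ?t {..k} = 1"
      using sum_simplical_face[OF zero(1), of "\<lambda>_. 1" ?t] t1 unfolding eq by simp
    then have "?t \<in> standard_simplex k"
      using t0 t_out zero(1) by (auto simp: standard_simplex_def)
    then have "?R (k, chain_face k i A, ?t) (Suc k, A, simplical_face i ?t)"
      "(k, chain_face k i A, ?t) \<in> topspace (realization_sum ?N)"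
      using A zero(1) realization_rel.face[of A ?N k i ?t chain_face chain_degen]
      by (auto simp: topspace_realization_sum chain_face_in_chain_space)
    then show ?thesis
      unfolding eq by (intro step) (auto intro: equivclp_sym r_into_equivclp)
  next
    case (eq i)
    let ?A = "chain_face k i A"
    have AA: "?A \<in> topspace (?N k)"
      using A eq(1) by (intro chain_face_in_chain_space) auto
    \<comment> \<open>Deleting one of two equal neighbours and repeating the other restores
      \<open>A\<close>; beyond \<open>Suc k\<close> both sides are \<open>undefined\<close>.\<close>
    have Aeq: "chain_degen k i ?A = A"
    proof
      fix j
      have "A j = undefined" if "\<not> j \<le> Suc k"
        using A that by (auto simp: topspace_chain_space PiE_iff extensional_def)
      then show "chain_degen k i ?A j = A j"
        using eq by (auto simp: chain_degen_def chain_face_def not_le less_Suc_eq_le)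
    qed
    have "sum (simplicial_degen i t) {..k} = 1"
      using sum_simplicial_degen[OF eq(1), of "\<lambda>_. 1" t] t1 by simp
    moreover have nonneg: "0 \<le> simplicial_degen i t j" for j
      using t0(1) by (simp add: simplicial_degen_def)
    moreover have out: "simplicial_degen i t j = 0" if "j > k" for j
      using t_out that eq(1) by (simp add: simplicial_degen_def)
    moreover have "simplicial_degen i t j \<le> 1" for j
    proof (cases "j \<le> k")
      case True
      then have "simplicial_degen i t j \<le> sum (simplicial_degen i t) {..k}"
        using nonneg by (intro member_le_sum) auto
      then show ?thesis using calculation(1) by simp
    qed (simp add: out)
    ultimately have "simplicial_degen i t \<in> standard_simplex k"
      by (simp add: standard_simplex_def)
    then have "?R (Suc k, chain_degen k i ?A, t) (k, ?A, simplicial_degen i t)"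
      "(k, ?A, simplicial_degen i t) \<in> topspace (realization_sum ?N)"
      using AA eq(1) t realization_rel.degen[of ?A ?N k i t chain_face chain_degen]
      by (auto simp: topspace_realization_sum)
    then show ?thesis
      unfolding Aeq by (intro step) (auto intro: r_into_equivclp)
  qed
qed

text \<open>Positive coordinates make the tail sums strictly decreasing. A point outside
  \<open>A i\<close> enters later, if at all, and weighs at most the tail from \<open>Suc i\<close>,
  which misses the level.\<close>

lemma chain_weight_superlevel:
  assumes nd: "nondegenerate (k, A, t)" and i: "i \<le> k"
  shows "{a. sum t {i..k} \<le> chain_weight (k, A, t) a} = A i"
proof -
  have A: "\<forall>i<k. A i \<subseteq> A (Suc i)" and t: "\<And>i. i \<le> k \<Longrightarrow> 0 < t i"
    using nd by (auto simp: nondegenerate_def)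
  have "sum t {i..k} \<le> chain_weight (k, A, t) a" if "a \<in> A i" for a
    using A i that by (rule chain_weight_ge_tail) (simp add: t less_imp_le)
  moreover have "chain_weight (k, A, t) a < sum t {i..k}" if "a \<notin> A i" for a
  proof -
    have "a \<notin> A j" if "j \<le> i" for j
      using chain_mono[OF A that i] \<open>a \<notin> A i\<close> by blast
    then have "chain_weight (k, A, t) a = (\<Sum>j\<in>{Suc i..k}. of_bool (a \<in> A j) * t j)"
      unfolding chain_weight_def prod.case
      by (intro sum.mono_neutral_right) (auto simp: not_less_eq_eq)
    also have "\<dots> \<le> sum t {Suc i..k}"
      using t by (intro sum_mono) (auto simp: less_imp_le)
    also have "\<dots> < sum t {i..k}"
      using t[OF i] i by (simp add: sum.atLeast_Suc_atMost)
    finally show ?thesis .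
  qed
  ultimately show ?thesis by (force simp: not_le)
qed

text \<open>Strictness provides a point entering exactly at \<open>i\<close>, so every tail sum is
  itself a value of the weight function.\<close>

lemma nondegenerate_new_point:
  assumes nd: "nondegenerate (k, A, t)" and A0: "A 0 \<noteq> {}" and i: "i \<le> k"
  obtains a where "a \<in> A i" "chain_weight (k, A, t) a = sum t {i..k}"
proof -
  have A: "\<forall>i<k. A i \<subseteq> A (Suc i)"
    using nd by (auto simp: nondegenerate_def)
  obtain a where a: "a \<in> A i" "\<And>j. j < i \<Longrightarrow> a \<notin> A j"
  proof (cases i)
    case 0
    then show thesis using A0 that by blast
  next
    case (Suc j)
    then have "A j \<subset> A i"
      using nd i by (auto simp: nondegenerate_def)
    then obtain a where "a \<in> A i" "a \<notin> A j"
      by blast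
    moreover have "A l \<subseteq> A j" if "l < i" for l
      using chain_mono[OF A, of l j] that Suc i by auto
    ultimately show thesis using that by blast
  qed
  then show thesis
    using that chain_weight_first[OF A i] by blast
qed

text \<open>A nondegenerate chain is recovered from its weight function as the family of superlevel sets.\<close>

lemma nondegenerate_superlevel_family:
  assumes nd: "nondegenerate (k, A, t)" and A0: "A 0 \<noteq> {}"
  shows "A ` {..k} = (\<lambda>v. {a. v \<le> chain_weight (k, A, t) a}) ` chain_weight (k, A, t) ` {a. chain_weight (k, A, t) a \<noteq> 0}"
    (is "_ = ?S ` ?f ` ?D")
proof
  have A: "\<forall>i<k. A i \<subseteq> A (Suc i)" and t: "\<And>i. i \<le> k \<Longrightarrow> 0 < t i"
    using nd by (auto simp: nondegenerate_def)
  show "A ` {..k} \<subseteq> ?S ` ?f ` ?D"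
  proof (rule image_subsetI)
    fix i assume "i \<in> {..k}"
    then have i: "i \<le> k" by simp
    obtain a where a: "a \<in> A i" "?f a = sum t {i..k}"
      using nondegenerate_new_point[OF nd A0 i] .
    have "0 < sum t {i..k}"
      using i t by (intro sum_pos) auto
    then have "a \<in> ?D" using a(2) by simp
    moreover have "A i = ?S (?f a)"
      unfolding a(2) using chain_weight_superlevel[OF nd i] by simp
    ultimately show "A i \<in> ?S ` ?f ` ?D" by blast
  qed
  show "?S ` ?f ` ?D \<subseteq> A ` {..k}"
  proof clarify
    fix a assume "?f a \<noteq> 0"
    then have ak: "a \<in> A k"
      using chain_weight_outside[OF A] by blast
    define i where "i = (LEAST i. a \<in> A i)"
    have i: "i \<le> k" "a \<in> A i" "\<And>j. j < i \<Longrightarrow> a \<notin> A j"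
      unfolding i_def using ak by (auto intro: Least_le LeastI dest: not_less_Least)
    have "?S (?f a) = A i"
      using chain_weight_superlevel[OF nd i(1)] chain_weight_first[OF A i] by (simp only:)
    then show "?S (?f a) \<in> A ` {..k}" using i(1) by blast
  qed
qed

lemma strict_chain_less:
  fixes A :: "nat \<Rightarrow> 'a set"
  assumes A: "\<forall>i<k. A i \<subset> A (Suc i)" and ij: "i \<le> k" "j \<le> k"
  shows "A i \<subset> A j \<longleftrightarrow> i < j"
proof -
  have weak: "\<forall>i<k. A i \<subseteq> A (Suc i)"
    using A by blast
  have "A i \<subset> A j" if "i < j" "j \<le> k" for i j
  proof -
    have "A i \<subset> A (Suc i)" using A that by simp
    also have "A (Suc i) \<subseteq> A j" using chain_mono[OF weak, of "Suc i" j] that by simp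
    finally show ?thesis .
  qed
  from this[of i j] this[of j i] show ?thesis
    using ij by (cases i j rule: linorder_cases) auto
qed

text \<open>Counting the members strictly below a given one recovers its index, so the unordered
  family of sets determines the chain.\<close>

lemma strict_chain_index:
  fixes A :: "nat \<Rightarrow> 'a set"
  assumes A: "\<forall>i<k. A i \<subset> A (Suc i)" and i: "i \<le> k"
  shows "card {S \<in> A ` {..k}. S \<subset> A i} = i"
proof -
  have "{S \<in> A ` {..k}. S \<subset> A i} = A ` {..<i}"
  proof (intro equalityI subsetI)
    fix S assume "S \<in> {S \<in> A ` {..k}. S \<subset> A i}"
    then obtain j where j: "j \<le> k" "S = A j" "A j \<subset> A i"
      by blast
    then have "j < i"
      using strict_chain_less[OF A j(1) i] by blast
    then show "S \<in> A ` {..<i}"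
      using j(2) by blast
  next
    fix S assume "S \<in> A ` {..<i}"
    then obtain j where j: "j < i" "S = A j"
      by blast
    then have "S \<subset> A i" "j \<le> k"
      using strict_chain_less[OF A _ i, of j] i by simp_all
    then show "S \<in> {S \<in> A ` {..k}. S \<subset> A i}"
      using j(2) by blast
  qed
  moreover have "inj_on A {..<i}"
  proof (rule inj_onI)
    fix l m assume "l \<in> {..<i}" "m \<in> {..<i}" "A l = A m"
    then have "\<not> l < m" "\<not> m < l"
      using strict_chain_less[OF A, of l m] strict_chain_less[OF A, of m l] i by auto
    then show "l = m" by simp
  qed
  ultimately show ?thesis by (simp add: card_image)
qed

text \<open>The superlevel sets give the same family, counting smaller members gives the same
  indexing, and each tail sum is the least weight on its member. Differences of successive tails are
  the coordinates.\<close>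

lemma nondegenerate_unique:
  assumes A: "(k, A, t) \<in> topspace (realization_sum (chain_space (exp_space n X) (\<subseteq>)))" "nondegenerate (k, A, t)"
    and B: "(l, B, s) \<in> topspace (realization_sum (chain_space (exp_space n X) (\<subseteq>)))" "nondegenerate (l, B, s)"
    and eq: "chain_weight (k, A, t) = chain_weight (l, B, s)"
  shows "(k, A, t) = (l, B, s)"
proof -
  let ?f = "chain_weight (k, A, t)"
  have A0: "A 0 \<noteq> {}" and B0: "B 0 \<noteq> {}"
    using A(1) B(1) by (auto simp: topspace_realization_sum topspace_chain_space topspace_exp_space PiE_iff)
  have sA: "\<forall>i<k. A i \<subset> A (Suc i)" and sB: "\<forall>i<l. B i \<subset> B (Suc i)"
    using A(2) B(2) by (auto simp: nondegenerate_def)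
  have fam: "A ` {..k} = B ` {..l}"
    using nondegenerate_superlevel_family[OF A(2) A0] nondegenerate_superlevel_family[OF B(2) B0]
    unfolding eq by simp
  have AB: "i \<le> l \<and> A i = B i" if "i \<le> k" for i
  proof -
    have "A i \<in> B ` {..l}"
      unfolding fam[symmetric] using that by simp
    then obtain j where j: "j \<le> l" "A i = B j"
      by auto
    then have "i = j"
      using strict_chain_index[OF sA that] strict_chain_index[OF sB j(1)] fam by simp
    then show ?thesis using j by simp
  qed
  have BA: "i \<le> k" if "i \<le> l" for i
  proof -
    have "B i \<in> A ` {..k}"
      unfolding fam using that by simp
    then obtain j where j: "j \<le> k" "B i = A j"
      by auto
    then have "i = j"
      using strict_chain_index[OF sB that] strict_chain_index[OF sA j(1)] fam by simp
    then show ?thesis using j by simp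
  qed
  have kl: "k = l"
    using AB[of k] BA[of l] by simp
  have extA: "A \<in> extensional {..k}" and extB: "B \<in> extensional {..k}"
    using A(1) B(1) kl by (auto simp: topspace_realization_sum topspace_chain_space PiE_iff)
  have AB': "A = B"
    using extA extB by (rule extensionalityI) (use AB in auto)
  \<comment> \<open>A point entering one chain at \<open>i\<close> attains the tail of that chain
    and, lying in the common set \<open>A i = B i\<close>, weighs at least the tail of the
    other.\<close>
  have tail: "sum t {i..k} = sum s {i..k}" if ik: "i \<le> k" for i
  proof -
    have il: "i \<le> l" using ik kl by simp
    obtain a where a: "a \<in> A i" "?f a = sum t {i..k}"
      using nondegenerate_new_point[OF A(2) A0 ik] .
    obtain b where b: "b \<in> B i" "chain_weight (l, B, s) b = sum s {i..l}"
      using nondegenerate_new_point[OF B(2) B0 il] .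
    have "a \<in> {a. sum s {i..l} \<le> chain_weight (l, B, s) a}"
      unfolding chain_weight_superlevel[OF B(2) il] using a(1) AB' by simp
    moreover have "b \<in> {a. sum t {i..k} \<le> ?f a}"
      unfolding chain_weight_superlevel[OF A(2) ik] using b(1) AB' by simp
    ultimately show ?thesis
      using a(2) b(2) kl eq by simp
  qed
  have "t i = s i" for i
  proof (cases "i \<le> k")
    case True
    \<comment> \<open>For \<open>i = k\<close> both tails are empty.\<close>
    have "sum t {Suc i..k} = sum s {Suc i..k}"
      using tail[of "Suc i"] by (cases "Suc i \<le> k") auto
    then show ?thesis
      using tail[OF True] True by (simp add: sum.atLeast_Suc_atMost)
  next
    case False
    then show ?thesis
      using A(1) B(1) kl by (auto simp: topspace_realization_sum standard_simplex_def)
  qed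
  then show ?thesis
    using kl AB' by auto
qed

text \<open>Weights are invariant under the generating relations. Conversely, equal weights pass to
  nondegenerate representatives, which then coincide.\<close>

lemma equivclp_iff_chain_weight_eq:
  assumes z: "z \<in> topspace (realization_sum (chain_space (exp_space n X) (\<subseteq>)))"
    and w: "w \<in> topspace (realization_sum (chain_space (exp_space n X) (\<subseteq>)))"
  shows "equivclp (realization_rel (chain_space (exp_space n X) (\<subseteq>)) chain_face chain_degen) z w
    \<longleftrightarrow> chain_weight z = chain_weight w" (is "equivclp ?R z w \<longleftrightarrow> _")
proof
  assume eq: "chain_weight z = chain_weight w"
  have norm: "\<exists>z' \<in> topspace (realization_sum (chain_space (exp_space n X) (\<subseteq>))). nondegenerate z' \<and> equivclp ?R z z'"
    if "z \<in> topspace (realization_sum (chain_space (exp_space n X) (\<subseteq>)))" for z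
    using nondegenerate_representative[of "fst z" "fst (snd z)" "snd (snd z)"] that by simp
  obtain z' where z': "z' \<in> topspace (realization_sum (chain_space (exp_space n X) (\<subseteq>)))" "nondegenerate z'" "equivclp ?R z z'"
    using norm[OF z] by blast
  obtain w' where w': "w' \<in> topspace (realization_sum (chain_space (exp_space n X) (\<subseteq>)))" "nondegenerate w'" "equivclp ?R w w'"
    using norm[OF w] by blast
  have "chain_weight z' = chain_weight w'"
    using chain_weight_equivclp[OF z'(3)] chain_weight_equivclp[OF w'(3)] eq by simp
  then have "z' = w'"
    using z'(1,2) w'(1,2) nondegenerate_unique
    by (cases z', cases w') blast
  then show "equivclp ?R z w"
    using z'(3) w'(3) by (meson equivclp_sym equivclp_trans)
qed (rule chain_weight_equivclp)


section \<open>The order complex as a space of fuzzy sets\<close>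

lemma continuous_map_Max:
  fixes f :: "'i \<Rightarrow> 'z \<Rightarrow> real"
  assumes "finite I" "I \<noteq> {}" "\<And>i. i \<in> I \<Longrightarrow> continuous_map Z euclideanreal (f i)"
  shows "continuous_map Z euclideanreal (\<lambda>z. Max ((\<lambda>i. f i z) ` I))"
  using assms
proof (induction I rule: finite_ne_induct)
  case (insert i I)
  then have "continuous_map Z euclideanreal (\<lambda>z. max (f i z) (Max ((\<lambda>i. f i z) ` I)))"
    by (intro continuous_map_real_max) auto
  then show ?case
    using insert by simp
qed simp

lemma continuous_map_from_sum_topology:
  assumes "\<And>i. i \<in> I \<Longrightarrow> continuous_map (X i) Y (\<lambda>x. f (i, x))"
  shows "continuous_map (sum_topology X I) Y f"
  unfolding continuous_map
proof (intro conjI allI impI)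
  show "f ` topspace (sum_topology X I) \<subseteq> topspace Y"
    using continuous_map_image_subset_topspace[OF assms] by (auto simp: image_subset_iff)
  fix U assume U: "openin Y U"
  have "openin (X i) {x \<in> topspace (X i). f (i, x) \<in> U}" if "i \<in> I" for i
    using openin_continuous_map_preimage[OF assms[OF that] U] .
  moreover have "{x. (i, x) \<in> {z \<in> topspace (sum_topology X I). f z \<in> U}} = {x \<in> topspace (X i). f (i, x) \<in> U}"
    if "i \<in> I" for i
    using that by auto
  ultimately show "openin (sum_topology X I) {z \<in> topspace (sum_topology X I). f z \<in> U}"
    unfolding openin_sum_topology by auto
qed

lemma openin_exp_space:
  assumes "openin X U"
  shows "openin (exp_space n X) {A \<in> topspace (exp_space n X). A \<subseteq> U}"
    and "openin (exp_space n X) {A \<in> topspace (exp_space n X). A \<inter> U \<noteq> {}}"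
proof -
  let ?B = "{{A. A \<subseteq> U} | U. openin X U} \<union> {{A. A \<inter> U \<noteq> {}} | U. openin X U}"
  let ?F = "{A. A \<subseteq> topspace X \<and> finite A \<and> A \<noteq> {} \<and> card A \<le> n}"
  have "openin (topology_generated_by ?B) {A. A \<subseteq> U}" "openin (topology_generated_by ?B) {A. A \<inter> U \<noteq> {}}"
    using assms by (auto intro!: topology_generated_by_Basis)
  then have "openin (exp_space n X) ({A. A \<subseteq> U} \<inter> ?F)" "openin (exp_space n X) ({A. A \<inter> U \<noteq> {}} \<inter> ?F)"
    unfolding exp_space_def vietoris_topology_def by (simp_all only: openin_subtopology_Int)
  moreover have "{A. A \<subseteq> U} \<inter> ?F = {A \<in> topspace (exp_space n X). A \<subseteq> U}"
    "{A. A \<inter> U \<noteq> {}} \<inter> ?F = {A \<in> topspace (exp_space n X). A \<inter> U \<noteq> {}}"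
    unfolding topspace_exp_space by auto
  ultimately show "openin (exp_space n X) {A \<in> topspace (exp_space n X). A \<subseteq> U}"
    "openin (exp_space n X) {A \<in> topspace (exp_space n X). A \<inter> U \<noteq> {}}"
    by simp_all
qed

lemma continuous_map_into_exp_space:
  assumes F: "\<And>z. z \<in> topspace Z \<Longrightarrow> F z \<in> topspace (exp_space n X)"
    and "\<And>U. openin X U \<Longrightarrow> openin Z {z \<in> topspace Z. F z \<subseteq> U}"
    and "\<And>U. openin X U \<Longrightarrow> openin Z {z \<in> topspace Z. F z \<inter> U \<noteq> {}}"
  shows "continuous_map Z (exp_space n X) F"
  unfolding exp_space_def vietoris_topology_def continuous_map_in_subtopology
proof
  show "F \<in> topspace Z \<rightarrow> {A. A \<subseteq> topspace X \<and> finite A \<and> A \<noteq> {} \<and> card A \<le> n}"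
    using F unfolding topspace_exp_space by blast
  show "continuous_map Z (topology_generated_by
      ({{A. A \<subseteq> U} | U. openin X U} \<union> {{A. A \<inter> U \<noteq> {}} | U. openin X U})) F"
  proof (rule continuous_on_generated_topo)
    fix V assume "V \<in> {{A. A \<subseteq> U} | U. openin X U} \<union> {{A. A \<inter> U \<noteq> {}} | U. openin X U}"
    then obtain U where "openin X U" "V = {A. A \<subseteq> U} \<or> V = {A. A \<inter> U \<noteq> {}}"
      by blast
    moreover have "F -` {A. A \<subseteq> U} \<inter> topspace Z = {z \<in> topspace Z. F z \<subseteq> U}"
      "F -` {A. A \<inter> U \<noteq> {}} \<inter> topspace Z = {z \<in> topspace Z. F z \<inter> U \<noteq> {}}" for U
      by auto
    ultimately show "openin Z (F -` V \<inter> topspace Z)"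
      using assms(2,3) by auto
  next
    have "F ` topspace Z \<subseteq> {A. A \<subseteq> topspace X}"
      using F unfolding topspace_exp_space by blast
    also have "{A. A \<subseteq> topspace X} \<subseteq> \<Union> ({{A. A \<subseteq> U} | U. openin X U} \<union> {{A. A \<inter> U \<noteq> {}} | U. openin X U})"
      by (intro Union_upper UnI1 CollectI exI[of _ "topspace X"]) simp
    finally show "F ` topspace Z \<subseteq> \<Union> ({{A. A \<subseteq> U} | U. openin X U} \<union> {{A. A \<inter> U \<noteq> {}} | U. openin X U})" .
  qed
qed

text \<open>The two kinds of Vietoris subbasic sets match the two semicontinuities: a maximum is
  below \<open>c\<close> if the set lies in an open sublevel set, above \<open>c\<close> if it meets
  an open superlevel set.\<close>

lemma continuous_map_exp_space_Max:
  assumes \<phi>: "continuous_map X euclideanreal \<phi>"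
  shows "continuous_map (exp_space n X) euclideanreal (\<lambda>A. Max (\<phi> ` A))"
  unfolding continuous_map_upper_lower_semicontinuous_lt
proof (intro allI conjI)
  fix c
  have fin: "finite (\<phi> ` A)" "\<phi> ` A \<noteq> {}" "A \<subseteq> topspace X" if "A \<in> topspace (exp_space n X)" for A
    using that by (simp_all add: topspace_exp_space)
  have o: "openin X {x \<in> topspace X. \<phi> x < c}" "openin X {x \<in> topspace X. c < \<phi> x}"
    using \<phi> unfolding continuous_map_upper_lower_semicontinuous_lt by blast+
  have "{A \<in> topspace (exp_space n X). Max (\<phi> ` A) < c} =
      {A \<in> topspace (exp_space n X). A \<subseteq> {x \<in> topspace X. \<phi> x < c}}"
    using fin by (auto simp: subset_iff)
  then show "openin (exp_space n X) {A \<in> topspace (exp_space n X). Max (\<phi> ` A) < c}"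
    using openin_exp_space(1)[OF o(1)] by simp
  have "{A \<in> topspace (exp_space n X). c < Max (\<phi> ` A)} =
      {A \<in> topspace (exp_space n X). A \<inter> {x \<in> topspace X. c < \<phi> x} \<noteq> {}}"
    using fin by (fastforce simp: Max_gr_iff)
  then show "openin (exp_space n X) {A \<in> topspace (exp_space n X). c < Max (\<phi> ` A)}"
    using openin_exp_space(2)[OF o(2)] by simp
qed

text \<open>Points of the smallest member collect all coordinates and get the value 1; the support
  lies in the largest member.\<close>

lemma chain_weight_in_fuzzy_sets:
  assumes "(k, A, t) \<in> topspace (realization_sum (chain_space (exp_space n X) (\<subseteq>)))"
  shows "chain_weight (k, A, t) \<in> fuzzy_sets n X"
proof -
  have AP: "\<And>i. i \<le> k \<Longrightarrow> A i \<in> topspace (exp_space n X)" and A: "\<forall>i<k. A i \<subseteq> A (Suc i)"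
    and t0: "\<And>i. 0 \<le> t i" and t1: "sum t {..k} = 1"
    using assms by (auto simp: topspace_realization_sum topspace_chain_space standard_simplex_def PiE_iff)
  let ?f = "chain_weight (k, A, t)"
  have nonneg: "0 \<le> ?f a" for a
    unfolding chain_weight_def prod.case using t0 by (intro sum_nonneg) auto
  have "?f a \<le> sum t {..k}" for a
    unfolding chain_weight_def prod.case using t0 by (intro sum_mono) auto
  then have le1: "?f a \<le> 1" for a
    using t1 by simp
  obtain a where "a \<in> A 0"
    using AP[of 0] by (auto simp: topspace_exp_space)
  then have a: "?f a = 1"
    using chain_weight_first[OF A, of 0 a t] t1 by (simp add: atMost_atLeast0)
  have sup: "{a. ?f a \<noteq> 0} \<subseteq> A k"
    using chain_weight_outside[OF A] by blast
  moreover have Ak: "finite (A k)" "A k \<subseteq> topspace X" "card (A k) \<le> n"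
    using AP[of k] by (simp_all add: topspace_exp_space)
  moreover have "card {a. ?f a \<noteq> 0} \<le> card (A k)"
    using sup Ak(1) by (intro card_mono)
  moreover have "{a. ?f a \<noteq> 0} \<noteq> {}"
    using a by force
  ultimately have "{a. ?f a \<noteq> 0} \<in> topspace (exp_space n X)"
    unfolding topspace_exp_space by (auto intro: finite_subset)
  then show ?thesis
    using nonneg le1 a by (auto simp: fuzzy_sets_def)
qed

text \<open>The entry index of a point jumps as the chain varies, but the maximum over all indices
  does not see this: counting a point at an index later than its entry only shrinks the tail factor.
  Finitely many continuous terms remain.\<close>

lemma fuzzy_max_chain_weight:
  assumes "(k, A, t) \<in> topspace (realization_sum (chain_space (exp_space n X) (\<subseteq>)))"
    and \<phi>: "\<phi> \<in> test_functions X"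
  shows "fuzzy_max (chain_weight (k, A, t)) \<phi> = Max ((\<lambda>i. sum t {i..k} * Max (\<phi> ` A i)) ` {..k})"
proof -
  have AP: "\<And>i. i \<le> k \<Longrightarrow> A i \<in> topspace (exp_space n X)" and A: "\<forall>i<k. A i \<subseteq> A (Suc i)"
    and t0: "\<And>i. 0 \<le> t i"
    using assms by (auto simp: topspace_realization_sum topspace_chain_space standard_simplex_def PiE_iff)
  have fin: "finite (A i)" "A i \<noteq> {}" "A i \<subseteq> topspace X" if "i \<le> k" for i
    using AP[OF that] by (simp_all add: topspace_exp_space)
  have \<phi>0: "0 \<le> \<phi> a" if "i \<le> k" "a \<in> A i" for i a
    using \<phi> fin(3)[OF that(1)] that(2) by (auto simp: test_functions_def)
  let ?f = "chain_weight (k, A, t)"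
  let ?m = "Max ((\<lambda>i. sum t {i..k} * Max (\<phi> ` A i)) ` {..k})"
  have "?m \<in> (\<lambda>i. sum t {i..k} * Max (\<phi> ` A i)) ` {..k}"
    by (intro Max_in) auto
  then obtain i where i: "i \<le> k" "?m = sum t {i..k} * Max (\<phi> ` A i)"
    by (metis (no_types, lifting) atMost_iff imageE)
  have "Max (\<phi> ` A i) \<in> \<phi> ` A i"
    using fin[OF i(1)] by (intro Max_in) auto
  then obtain b where b: "b \<in> A i" "Max (\<phi> ` A i) = \<phi> b"
    by auto
  have m0: "0 \<le> ?m"
    unfolding i(2) b(2) using t0 \<phi>0[OF i(1) b(1)] by (simp add: sum_nonneg)
  have up: "?f a * \<phi> a \<le> ?m" for a
  proof (cases "a \<in> A k")
    case False
    then show ?thesis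
      using chain_weight_outside[OF A] m0 by simp
  next
    case True
    define j where "j = (LEAST i. a \<in> A i)"
    have j: "j \<le> k" "a \<in> A j" "\<And>l. l < j \<Longrightarrow> a \<notin> A l"
      unfolding j_def using True by (auto intro: Least_le LeastI dest: not_less_Least)
    have "?f a * \<phi> a = sum t {j..k} * \<phi> a"
      using chain_weight_first[OF A j] by simp
    also have "\<dots> \<le> sum t {j..k} * Max (\<phi> ` A j)"
      using t0 fin(1)[OF j(1)] j(2) by (intro mult_left_mono sum_nonneg Max_ge) auto
    also have "\<dots> \<le> ?m"
      using j(1) by (intro Max_ge) auto
    finally show ?thesis .
  qed
  have "?m \<le> ?f b * \<phi> b"
    unfolding i(2) b(2) using \<phi>0[OF i(1) b(1)]
    by (intro mult_right_mono chain_weight_ge_tail[OF A i(1) b(1)] t0)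
  with up[of b] have "?f b * \<phi> b = ?m"
    by (rule antisym)
  then show ?thesis
    using fuzzy_max_eqI[OF fuzzy_setsD(3)[OF chain_weight_in_fuzzy_sets[OF assms(1)]] up] by blast
qed

lemma continuous_map_chain_weight:
  "continuous_map (realization_sum (chain_space (exp_space n X) (\<subseteq>))) (fuzzy_space n X) chain_weight"
proof (rule continuous_map_into_fuzzy_space)
  let ?N = "chain_space (exp_space n X) (\<subseteq>)"
  show "chain_weight z \<in> fuzzy_sets n X" if "z \<in> topspace (realization_sum ?N)" for z
    using that chain_weight_in_fuzzy_sets by (cases z) blast
  fix \<phi> assume \<phi>: "\<phi> \<in> test_functions X"
  show "continuous_map (realization_sum ?N) euclideanreal (\<lambda>z. fuzzy_max (chain_weight z) \<phi>)"
    unfolding realization_sum_def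
  proof (rule continuous_map_from_sum_topology)
    fix k
    let ?Z = "prod_topology (?N k) (simplex_space k)"
    have coord: "continuous_map ?Z euclideanreal (\<lambda>u. snd u i)" for i
    proof -
      have "continuous_map (simplex_space k) euclideanreal (\<lambda>t. t i)"
        by (intro continuous_map_from_subtopology continuous_map_product_projection) simp
      from continuous_map_compose[OF continuous_map_snd this] show ?thesis
        by (simp add: o_def)
    qed
    have val: "continuous_map ?Z euclideanreal (\<lambda>u. Max (\<phi> ` fst u i))" if "i \<le> k" for i
    proof -
      have "continuous_map (?N k) (exp_space n X) (\<lambda>x. x i)"
        unfolding chain_space_def using that
        by (intro continuous_map_from_subtopology continuous_map_product_projection) simp
      from continuous_map_compose[OF continuous_map_fst this]
      have "continuous_map ?Z (exp_space n X) (\<lambda>u. fst u i)"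
        by (simp add: o_def)
      moreover have "continuous_map (exp_space n X) euclideanreal (\<lambda>A. Max (\<phi> ` A))"
        using \<phi> by (intro continuous_map_exp_space_Max) (simp add: test_functions_def)
      ultimately have "continuous_map ?Z euclideanreal ((\<lambda>A. Max (\<phi> ` A)) \<circ> (\<lambda>u. fst u i))"
        by (rule continuous_map_compose)
      then show ?thesis by (simp add: o_def)
    qed
    have "continuous_map ?Z euclideanreal
        (\<lambda>u. Max ((\<lambda>i. sum (snd u) {i..k} * Max (\<phi> ` fst u i)) ` {..k}))"
      by (intro continuous_map_Max continuous_map_real_mult continuous_map_sum coord val) auto
    then show "continuous_map ?Z euclideanreal (\<lambda>u. fuzzy_max (chain_weight (k, u)) \<phi>)"
    proof (rule continuous_map_eq)
      fix u assume "u \<in> topspace ?Z"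
      then have "(k, fst u, snd u) \<in> topspace (realization_sum ?N)"
        by (auto simp: topspace_realization_sum)
      from fuzzy_max_chain_weight[OF this \<phi>]
      show "Max ((\<lambda>i. sum (snd u) {i..k} * Max (\<phi> ` fst u i)) ` {..k}) = fuzzy_max (chain_weight (k, u)) \<phi>"
        by simp
    qed
  qed
qed

text \<open>Every chain of sets with at most \<open>n\<close> elements is refined by the prefixes of an enumeration, so
  the prefix chains parametrise the order complex by a compact space.\<close>

definition prefix_chain :: "nat \<Rightarrow> (nat \<Rightarrow> 'a) \<times> (nat \<Rightarrow> real) \<Rightarrow> nat \<times> (nat \<Rightarrow> 'a set) \<times> (nat \<Rightarrow> real)" where
  "prefix_chain n = (\<lambda>(x, t). (n - 1, (\<lambda>j\<in>{..n - 1}. x ` {..j}), t))"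

abbreviation prefix_domain :: "nat \<Rightarrow> 'a topology \<Rightarrow> ((nat \<Rightarrow> 'a) \<times> (nat \<Rightarrow> real)) topology" where
  "prefix_domain n X \<equiv> prod_topology (product_topology (\<lambda>_. X) {..<n}) (simplex_space (n - 1))"

lemma compact_prefix_domain:
  assumes "compact_space X"
  shows "compact_space (prefix_domain n X)"
  using assms by (simp add: compact_space_prod_topology compact_space_product_topology
      compact_space_subtopology compactin_standard_simplex)

lemma image_prefix_in_exp_space:
  assumes "x \<in> topspace (product_topology (\<lambda>_. X) {..<n})" "j < n"
  shows "x ` {..j} \<in> topspace (exp_space n X)"
proof -
  have "x ` {..j} \<subseteq> topspace X"
    using assms by (auto simp: topspace_product_topology PiE_iff)
  moreover have "card (x ` {..j}) \<le> n"
    using card_image_le[of "{..j}" x] assms(2) by simp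
  ultimately show ?thesis by (simp add: topspace_exp_space)
qed

lemma continuous_map_image_prefix:
  assumes "j < n"
  shows "continuous_map (product_topology (\<lambda>_. X) {..<n}) (exp_space n X) (\<lambda>x. x ` {..j})"
proof (rule continuous_map_into_exp_space)
  let ?Z = "product_topology (\<lambda>_. X) {..<n}"
  show "x ` {..j} \<in> topspace (exp_space n X)" if "x \<in> topspace ?Z" for x
    using that assms by (rule image_prefix_in_exp_space)
  fix U assume U: "openin X U"
  have op: "openin ?Z {x \<in> topspace ?Z. x i \<in> U}" if "i \<le> j" for i
    using that assms by (intro openin_continuous_map_preimage[OF _ U] continuous_map_product_projection) auto
  have "openin ?Z (\<Inter>i\<le>j. {x \<in> topspace ?Z. x i \<in> U})"
    using op by (intro openin_INT2) auto
  moreover have "(\<Inter>i\<le>j. {x \<in> topspace ?Z. x i \<in> U}) = {x \<in> topspace ?Z. x ` {..j} \<subseteq> U}"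
    by auto
  ultimately show "openin ?Z {x \<in> topspace ?Z. x ` {..j} \<subseteq> U}"
    by (simp only:)
  have "openin ?Z (\<Union>i\<le>j. {x \<in> topspace ?Z. x i \<in> U})"
    using op by (intro openin_Union) auto
  moreover have "(\<Union>i\<le>j. {x \<in> topspace ?Z. x i \<in> U}) = {x \<in> topspace ?Z. x ` {..j} \<inter> U \<noteq> {}}"
    by auto
  ultimately show "openin ?Z {x \<in> topspace ?Z. x ` {..j} \<inter> U \<noteq> {}}"
    by (simp only:)
qed

lemma continuous_map_prefix_chain:
  assumes n: "n \<ge> 1"
  shows "continuous_map (prefix_domain n X) (realization_sum (chain_space (exp_space n X) (\<subseteq>))) (prefix_chain n)"
proof -
  let ?N = "chain_space (exp_space n X) (\<subseteq>)"
  let ?A = "\<lambda>x. \<lambda>j\<in>{..n - 1}. x ` {..j}"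
  have "continuous_map (product_topology (\<lambda>_. X) {..<n}) (?N (n - 1)) ?A"
    unfolding chain_space_def continuous_map_in_subtopology continuous_map_componentwise
  proof (intro conjI ballI)
    show "?A ` topspace (product_topology (\<lambda>_. X) {..<n}) \<subseteq> extensional {..n - 1}"
      by (intro image_subsetI restrict_extensional)
    show "?A \<in> topspace (product_topology (\<lambda>_. X) {..<n}) \<rightarrow> {x. \<forall>i<n - 1. x i \<subseteq> x (Suc i)}"
      by (intro funcsetI CollectI allI impI) (simp add: image_mono)
    fix j assume "j \<in> {..n - 1}"
    then show "continuous_map (product_topology (\<lambda>_. X) {..<n}) (exp_space n X) (\<lambda>x. ?A x j)"
      using n by (simp add: continuous_map_image_prefix)
  qed
  then have "continuous_map (prefix_domain n X) (prod_topology (?N (n - 1)) (simplex_space (n - 1)))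
      (\<lambda>u. (?A (fst u), snd u))"
    using continuous_map_compose[OF continuous_map_fst, of "product_topology (\<lambda>_. X) {..<n}" "?N (n - 1)" ?A]
    by (intro continuous_map_pairedI continuous_map_snd) (simp add: o_def)
  moreover have "continuous_map (prod_topology (?N (n - 1)) (simplex_space (n - 1))) (realization_sum ?N)
      (\<lambda>u. (n - 1, u))"
    unfolding realization_sum_def by (rule continuous_map_component_injection) simp
  ultimately have "continuous_map (prefix_domain n X) (realization_sum ?N)
      ((\<lambda>u. (n - 1, u)) \<circ> (\<lambda>u. (?A (fst u), snd u)))"
    by (rule continuous_map_compose)
  then show ?thesis
    by (simp add: prefix_chain_def o_def case_prod_unfold)
qed

text \<open>List the support by decreasing values of \<open>f\<close> and take the differences of
  successive values as coordinates. The tail from \<open>j\<close> telescopes to the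
  \<open>j\<close>-th value, which is the weight of the point entering at \<open>j\<close>.\<close>

lemma prefix_chain_surj:
  assumes f: "f \<in> fuzzy_sets n X" and n: "n \<ge> 1"
  obtains u where "u \<in> topspace (prefix_domain n X)" "chain_weight (prefix_chain n u) = f"
proof -
  let ?S = "{a. f a \<noteq> 0}"
  have fin: "finite ?S" and cn: "card ?S \<le> n" and SX: "?S \<subseteq> topspace X"
    using fuzzy_setsD[OF f] by blast+
  define xs where "xs = sort_key (\<lambda>a. - f a) (SOME l. set l = ?S \<and> distinct l)"
  have "set (SOME l. set l = ?S \<and> distinct l) = ?S \<and> distinct (SOME l. set l = ?S \<and> distinct l)"
    using finite_distinct_list[OF fin] by (rule someI_ex)
  then have xs: "set xs = ?S" "distinct xs" and srt: "sorted (map (\<lambda>a. - f a) xs)"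
    by (simp_all add: xs_def)
  let ?m = "length xs"
  have m: "?m \<le> n"
    using cn xs by (metis distinct_card)
  obtain b where b: "f b = 1"
    using fuzzy_setsD(6)[OF f] by blast
  then have "b \<in> set xs"
    using xs(1) by simp
  then have mpos: "0 < ?m"
    by (cases xs) auto
  have dec: "f (xs ! j) \<le> f (xs ! i)" if "i \<le> j" "j < ?m" for i j
    using sorted_nth_mono[OF srt that(1)] that by simp
  \<comment> \<open>The value 0 past the support makes the last listed value a difference too, and
    lets all coordinates of the padding vanish.\<close>
  define \<tau> where "\<tau> j = (if j < ?m then f (xs ! j) else 0)" for j
  have f0: "0 \<le> f a" "f a \<le> 1" for a
    using fuzzy_setsD(1,2)[OF f] by blast+
  have \<tau>dec: "\<tau> (Suc j) \<le> \<tau> j" for j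
    using dec[of j "Suc j"] f0 by (auto simp: \<tau>_def)
  have \<tau>0: "\<tau> 0 = 1"
  proof -
    obtain j where "j < ?m" "b = xs ! j"
      using \<open>b \<in> set xs\<close> by (auto simp: in_set_conv_nth)
    then have "1 \<le> f (xs ! 0)"
      using dec[of 0 j] b by simp
    then show ?thesis
      using f0(2)[of "xs ! 0"] mpos by (simp add: \<tau>_def)
  qed
  define t where "t j = \<tau> j - \<tau> (Suc j)" for j
  have tail: "sum t {i..n - 1} = \<tau> i" if "i < n" for i
  proof -
    have "sum t {i..n - 1} = \<tau> i - \<tau> (Suc (n - 1))"
      unfolding t_def using sum_Suc_diff[of i "n - 1" "\<lambda>j. - \<tau> j"] that by simp
    then show ?thesis
      using m n by (simp add: \<tau>_def)
  qed
  have t: "t \<in> standard_simplex (n - 1)"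
  proof -
    have "0 \<le> \<tau> j" "\<tau> j \<le> 1" for j
      using f0 by (simp_all add: \<tau>_def)
    then have "0 \<le> t j" "t j \<le> 1" for j
      using \<tau>dec[of j] unfolding t_def by (smt (verit))+
    moreover have "t j = 0" if "j > n - 1" for j
      using that m n by (auto simp: t_def \<tau>_def)
    moreover have "sum t {..n - 1} = 1"
      using tail[of 0] n \<tau>0 by (simp add: atMost_atLeast0)
    ultimately show ?thesis
      by (simp add: standard_simplex_def)
  qed
  \<comment> \<open>The surplus entries repeat the first point, so that no prefix gains a new
    element from them.\<close>
  define x where "x = (\<lambda>j\<in>{..<n}. if j < ?m then xs ! j else xs ! 0)"
  have xS: "x j \<in> ?S" if "j < n" for j
    using that mpos xs(1) nth_mem by (auto simp: x_def)
  then have x: "x \<in> topspace (product_topology (\<lambda>_. X) {..<n})"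
    using SX by (auto simp: topspace_product_topology x_def)
  let ?A = "\<lambda>j\<in>{..n - 1}. x ` {..j}"
  have A: "\<forall>i<n - 1. ?A i \<subseteq> ?A (Suc i)"
    by auto
  have "chain_weight (prefix_chain n (x, t)) a = f a" for a
  proof (cases "a \<in> ?S")
    case False
    have "a \<notin> ?A (n - 1)" (is "?out")
    proof
      assume "a \<in> ?A (n - 1)"
      then obtain j where "j \<le> n - 1" "a = x j" by auto
      then show False using xS[of j] False n by simp
    qed
    have "f a = 0"
      using False by simp
    then show ?thesis
      unfolding prefix_chain_def prod.case
      using chain_weight_outside[OF A \<open>?out\<close>, of t] by (simp only:)
  next
    case True
    then obtain j where j: "j < ?m" "a = xs ! j"
      using xs(1) by (metis in_set_conv_nth)
    have jn: "j \<le> n - 1" "j < n"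
      using j(1) m by auto
    have "a = x j"
      using j jn by (simp add: x_def)
    then have "a \<in> ?A j"
      using jn by auto
    moreover have "a \<notin> ?A i" if "i < j" for i
    proof
      assume "a \<in> ?A i"
      moreover have "i \<le> n - 1"
        using that jn(1) by (rule less_le_trans[THEN less_imp_le])
      ultimately obtain l where l: "l \<le> i" "a = x l"
        by (auto simp del: One_nat_def)
      then have "a = xs ! l"
        using that j jn by (simp add: x_def)
      then show False
        using xs(2) j l(1) that by (simp add: nth_eq_iff_index_eq)
    qed
    ultimately have "chain_weight (n - 1, ?A, t) a = sum t {j..n - 1}"
      using chain_weight_first[OF A jn(1)] by blast
    then show ?thesis
      using tail[OF jn(2)] j by (simp add: prefix_chain_def \<tau>_def)
  qed
  then show thesis
    using that[of "(x, t)"] x t by (simp add: fun_eq_iff)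
qed

section \<open>Compactness of the order complex and its identification with fuzzy sets\<close>

definition order_complex_class :: "'p topology \<Rightarrow> ('p \<Rightarrow> 'p \<Rightarrow> bool) \<Rightarrow>
    nat \<times> (nat \<Rightarrow> 'p) \<times> (nat \<Rightarrow> real) \<Rightarrow> (nat \<times> (nat \<Rightarrow> 'p) \<times> (nat \<Rightarrow> real)) set" where
  "order_complex_class P leq = quotient_class (realization_sum (chain_space P leq))
     (realization_rel (chain_space P leq) chain_face chain_degen)"

lemma quotient_map_order_complex_class:
  "quotient_map (realization_sum (chain_space P leq)) (order_complex P leq) (order_complex_class P leq)"
  unfolding order_complex_class_def order_complex_def geometric_realization_def
  by (rule quotient_map_quotient_class)

lemma quotient_class_eq_iff:
  assumes "x \<in> topspace X" "y \<in> topspace X"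
  shows "quotient_class X r x = quotient_class X r y \<longleftrightarrow> equivclp r x y"
proof
  assume "quotient_class X r x = quotient_class X r y"
  moreover have "y \<in> quotient_class X r y"
    using assms(2) by (simp add: quotient_class_def)
  ultimately have "y \<in> quotient_class X r x"
    by simp
  then show "equivclp r x y"
    by (simp add: quotient_class_def)
next
  assume "equivclp r x y"
  then have "equivclp r x z \<longleftrightarrow> equivclp r y z" for z
    using equivclp_sym equivclp_trans by metis
  then show "quotient_class X r x = quotient_class X r y"
    by (simp add: quotient_class_def)
qed

text \<open>Weights descend to an injective continuous map on classes. As prefix chains meet every
  class, the complex is the image of a compact space, and a continuous bijection from it onto a
  Hausdorff space is a homeomorphism.\<close>

lemma order_complex_homeomorphic_fuzzy_space:
  assumes X: "compact_space X" "Hausdorff_space X" and n: "n \<ge> 1"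
  obtains e where "homeomorphic_map (order_complex (exp_space n X) (\<subseteq>)) (fuzzy_space n X) e"
    "\<And>z. z \<in> topspace (realization_sum (chain_space (exp_space n X) (\<subseteq>))) \<Longrightarrow>
       e (order_complex_class (exp_space n X) (\<subseteq>) z) = chain_weight z"
    "compact_space (order_complex (exp_space n X) (\<subseteq>))"
proof -
  let ?S = "realization_sum (chain_space (exp_space n X) (\<subseteq>))"
  let ?D = "order_complex (exp_space n X) (\<subseteq>)"
  let ?c = "order_complex_class (exp_space n X) (\<subseteq>)"
  note q = quotient_map_order_complex_class[of "exp_space n X" "(\<subseteq>)"]
  have eq: "?c z = ?c w \<longleftrightarrow> chain_weight z = chain_weight w" if "z \<in> topspace ?S" "w \<in> topspace ?S" for z w
    unfolding order_complex_class_def quotient_class_eq_iff[OF that] equivclp_iff_chain_weight_eq[OF that] ..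
  obtain e where e: "continuous_map ?D (fuzzy_space n X) e"
    and e_img: "e ` topspace ?D = chain_weight ` topspace ?S"
    and ec: "\<And>z. z \<in> topspace ?S \<Longrightarrow> e (?c z) = chain_weight z"
    using quotient_map_lift_exists[OF q continuous_map_chain_weight] eq by metis
  have surjc: "?c ` topspace ?S = topspace ?D"
    using q by (rule quotient_imp_surjective_map)
  have inj: "inj_on e (topspace ?D)"
    unfolding surjc[symmetric]
  proof (rule inj_onI, elim imageE)
    fix c d z w assume "e c = e d" and z: "c = ?c z" "z \<in> topspace ?S" and w: "d = ?c w" "w \<in> topspace ?S"
    then show "c = d"
      by (simp only: z(1) w(1) ec[OF z(2)] ec[OF w(2)] eq[OF z(2) w(2)])
  qed
  have psi: "continuous_map (prefix_domain n X) ?S (prefix_chain n)"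
    using n by (rule continuous_map_prefix_chain)
  then have pS: "prefix_chain n u \<in> topspace ?S" if "u \<in> topspace (prefix_domain n X)" for u
    using continuous_map_image_subset_topspace[OF psi] that by blast
  have fuzzy_img: "fuzzy_sets n X \<subseteq> chain_weight ` prefix_chain n ` topspace (prefix_domain n X)"
    using prefix_chain_surj[OF _ n] by blast
  have onto: "e ` topspace ?D = topspace (fuzzy_space n X)"
  proof
    show "e ` topspace ?D \<subseteq> topspace (fuzzy_space n X)"
      using e by (rule continuous_map_image_subset_topspace)
    have "chain_weight ` prefix_chain n ` topspace (prefix_domain n X) \<subseteq> chain_weight ` topspace ?S"
      using pS by blast
    then show "topspace (fuzzy_space n X) \<subseteq> e ` topspace ?D"
      unfolding e_img using fuzzy_img by simp
  qed
  \<comment> \<open>Every class contains a prefix chain: one of the same weight exists, and equal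
    weights mean equal classes.\<close>
  have "?c ` prefix_chain n ` topspace (prefix_domain n X) = topspace ?D"
  proof
    show "?c ` prefix_chain n ` topspace (prefix_domain n X) \<subseteq> topspace ?D"
      unfolding surjc[symmetric] using pS by blast
    show "topspace ?D \<subseteq> ?c ` prefix_chain n ` topspace (prefix_domain n X)"
    proof
      fix c assume "c \<in> topspace ?D"
      then obtain z where z: "z \<in> topspace ?S" "c = ?c z"
        using surjc by blast
      then have "chain_weight z \<in> fuzzy_sets n X"
        using continuous_map_image_subset_topspace[OF continuous_map_chain_weight, of n X] by (simp add: image_subset_iff)
      then obtain u where u: "u \<in> topspace (prefix_domain n X)" "chain_weight z = chain_weight (prefix_chain n u)"
        using fuzzy_img by blast
      then have "c = ?c (prefix_chain n u)"
        using eq[OF z(1) pS[OF u(1)]] z(2) by simp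
      then show "c \<in> ?c ` prefix_chain n ` topspace (prefix_domain n X)"
        using u(1) by blast
    qed
  qed
  moreover have "compact_space (prefix_domain n X)"
    using X(1) by (rule compact_prefix_domain)
  ultimately have D: "compact_space ?D"
    using image_compactin[OF _ continuous_map_compose[OF psi quotient_imp_continuous_map[OF q]], of "topspace (prefix_domain n X)"]
    by (simp add: compact_space_def image_comp)
  show thesis
  proof (rule that[OF _ ec D])
    show "homeomorphic_map ?D (fuzzy_space n X) e"
      using e D Hausdorff_fuzzy_space[OF X] onto inj by (rule continuous_imp_homeomorphic_map)
  qed
qed


section \<open>The top stratum and the Thom space\<close>

lemma quotient_maps_homeomorphic:
  assumes f: "quotient_map Z A f" and g: "quotient_map Z B g"
    and eq: "\<And>x y. x \<in> topspace Z \<Longrightarrow> y \<in> topspace Z \<Longrightarrow> f x = f y \<longleftrightarrow> g x = g y"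
  obtains p where "homeomorphic_map A B p"
proof -
  obtain p where p: "continuous_map A B p" "\<And>z. z \<in> topspace Z \<Longrightarrow> p (f z) = g z"
    using quotient_map_lift_exists[OF f quotient_imp_continuous_map[OF g]] eq by metis
  obtain r where r: "continuous_map B A r" "\<And>z. z \<in> topspace Z \<Longrightarrow> r (g z) = f z"
    using quotient_map_lift_exists[OF g quotient_imp_continuous_map[OF f]] eq by metis
  have "homeomorphic_maps A B p r"
    unfolding homeomorphic_maps_def
    using p r quotient_imp_surjective_map[OF f] quotient_imp_surjective_map[OF g] by force
  then show thesis
    using that homeomorphic_map_maps by blast
qed

text \<open>The weight functions of the points of the order complex outside of \<open>\<Delta>(\<R>)\<close>.\<close>

definition top_stratum :: "nat \<Rightarrow> 'a topology \<Rightarrow> 'a \<Rightarrow> ('a \<Rightarrow> real) set" where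
  "top_stratum n X x0 = {f \<in> fuzzy_sets n X. card {a. f a \<noteq> 0} = n \<and> f x0 = 0}"

text \<open>The part of the parametrisation that lies over the top stratum. Positivity of the last
  coordinate suffices: it is the weight of \<open>x (n - 1)\<close> and a summand of the weights of
  the other entries.\<close>

definition ordered_cells :: "nat \<Rightarrow> 'a topology \<Rightarrow> 'a \<Rightarrow> ((nat \<Rightarrow> 'a) \<times> (nat \<Rightarrow> real)) set" where
  "ordered_cells n X x0 = {(x, t). inj_on x {..<n} \<and> (\<forall>i<n. x i \<noteq> x0) \<and> t (n - 1) > 0}"

lemma prefix_chain_in_realization_sum:
  assumes "u \<in> topspace (prefix_domain n X)" "n \<ge> 1"
  shows "prefix_chain n u \<in> topspace (realization_sum (chain_space (exp_space n X) (\<subseteq>)))"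
  using continuous_map_image_subset_topspace[OF continuous_map_prefix_chain[OF assms(2)]] imageI[OF assms(1)]
  by (rule subsetD)

lemma prefix_chain_weight_eq:
  assumes x: "inj_on x {..<n}" and j: "j < n"
  shows "chain_weight (prefix_chain n (x, t)) (x j) = sum t {j..n - 1}"
proof -
  let ?A = "\<lambda>j\<in>{..n - 1}. x ` {..j}"
  have A: "\<forall>i<n - 1. ?A i \<subseteq> ?A (Suc i)"
    by auto
  have jn: "j \<le> n - 1"
    using j by simp
  moreover have "x j \<in> ?A j"
    using jn by simp
  moreover have "x j \<notin> ?A i" if "i < j" for i
    using that j inj_onD[OF x, of j] by (auto simp: image_iff)
  ultimately show ?thesis
    unfolding prefix_chain_def prod.case by (rule chain_weight_first[OF A])
qed

lemma prefix_chain_weight_support: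
  assumes "n \<ge> 1"
  shows "{a. chain_weight (prefix_chain n (x, t)) a \<noteq> 0} \<subseteq> x ` {..<n}"
proof
  let ?A = "\<lambda>j\<in>{..n - 1}. x ` {..j}"
  have A: "\<forall>i<n - 1. ?A i \<subseteq> ?A (Suc i)"
    by auto
  have An: "?A (n - 1) = x ` {..<n}"
    using assms by (auto simp: image_iff Bex_def less_eq_Suc_le)
  fix a assume "a \<in> {a. chain_weight (prefix_chain n (x, t)) a \<noteq> 0}"
  then show "a \<in> x ` {..<n}"
    using chain_weight_outside[OF A, of a t] An unfolding prefix_chain_def prod.case by blast
qed

text \<open>The support lies in the image of \<open>x\<close>, so \<open>n\<close> support points
  force \<open>x\<close> to be injective with that image as support. Conversely each weight is a
  tail sum that contains the positive last coordinate.\<close>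

lemma prefix_chain_top_stratum_iff:
  assumes u: "(x, t) \<in> topspace (prefix_domain n X)" and n: "n \<ge> 1"
  shows "chain_weight (prefix_chain n (x, t)) \<in> top_stratum n X x0 \<longleftrightarrow> (x, t) \<in> ordered_cells n X x0"
proof -
  let ?f = "chain_weight (prefix_chain n (x, t))"
  have t0: "0 \<le> t j" for j
    using u by (simp add: standard_simplex_def)
  have f: "?f \<in> fuzzy_sets n X"
    using prefix_chain_in_realization_sum[OF u n] chain_weight_in_fuzzy_sets
    unfolding prefix_chain_def prod.case by blast
  note sup = prefix_chain_weight_support[OF n, of x t]
  have cx: "card (x ` {..<n}) \<le> n"
    using card_image_le[of "{..<n}" x] by simp
  show ?thesis
  proof
    assume W: "?f \<in> top_stratum n X x0"
    then have c: "card {a. ?f a \<noteq> 0} = n" "?f x0 = 0"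
      by (simp_all add: top_stratum_def)
    have eq: "{a. ?f a \<noteq> 0} = x ` {..<n}"
      using sup cx c(1) by (intro card_seteq) auto
    then have inj: "inj_on x {..<n}"
      using c(1) by (intro eq_card_imp_inj_on) simp_all
    moreover have "x i \<noteq> x0" if "i < n" for i
      using eq c(2) that by blast
    moreover have "x (n - 1) \<in> {a. ?f a \<noteq> 0}"
      unfolding eq using n by simp
    then have "t (n - 1) \<noteq> 0"
      using prefix_chain_weight_eq[OF inj, of "n - 1" t] n by simp
    ultimately show "(x, t) \<in> ordered_cells n X x0"
      using t0[of "n - 1"] by (simp add: ordered_cells_def)
  next
    assume "(x, t) \<in> ordered_cells n X x0"
    then have inj: "inj_on x {..<n}" and x0: "\<And>i. i < n \<Longrightarrow> x i \<noteq> x0" and tn: "t (n - 1) > 0"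
      by (auto simp: ordered_cells_def)
    have "?f (x j) \<noteq> 0" if "j < n" for j
    proof -
      have "t (n - 1) \<le> sum t {j..n - 1}"
        using that t0 by (intro member_le_sum) auto
      then show ?thesis
        using prefix_chain_weight_eq[OF inj that, of t] tn by simp
    qed
    then have eq: "{a. ?f a \<noteq> 0} = x ` {..<n}"
      using sup by blast
    then have "card {a. ?f a \<noteq> 0} = n"
      using inj by (simp add: card_image)
    moreover have "x0 \<notin> {a. ?f a \<noteq> 0}"
      unfolding eq using x0 by auto
    then have "?f x0 = 0"
      by simp
    ultimately show "?f \<in> top_stratum n X x0"
      using f by (simp add: top_stratum_def)
  qed
qed

text \<open>Openness of the top stratum, and later the quotient property of its cells, can be tested
  on this compact parametrisation.\<close>

lemma quotient_map_prefix_chain_weight: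
  assumes X: "compact_space X" "Hausdorff_space X" and n: "n \<ge> 1"
  shows "quotient_map (prefix_domain n X) (fuzzy_space n X) (chain_weight \<circ> prefix_chain n)"
proof (rule continuous_imp_quotient_map)
  show cont: "continuous_map (prefix_domain n X) (fuzzy_space n X) (chain_weight \<circ> prefix_chain n)"
    using continuous_map_prefix_chain[OF n] continuous_map_chain_weight by (rule continuous_map_compose)
  show "compact_space (prefix_domain n X)"
    using X(1) by (rule compact_prefix_domain)
  show "Hausdorff_space (fuzzy_space n X)"
    using X by (rule Hausdorff_fuzzy_space)
  have "topspace (fuzzy_space n X) \<subseteq> (chain_weight \<circ> prefix_chain n) ` topspace (prefix_domain n X)"
  proof
    fix f assume "f \<in> topspace (fuzzy_space n X)"
    then have "f \<in> fuzzy_sets n X" by simp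
    then obtain u where "u \<in> topspace (prefix_domain n X)" "chain_weight (prefix_chain n u) = f"
      using prefix_chain_surj[OF _ n] by metis
    then show "f \<in> (chain_weight \<circ> prefix_chain n) ` topspace (prefix_domain n X)"
      by (metis comp_apply image_eqI)
  qed
  with continuous_map_image_subset_topspace[OF cont]
  show "(chain_weight \<circ> prefix_chain n) ` topspace (prefix_domain n X) = topspace (fuzzy_space n X)"
    by (rule antisym)
qed

lemma openin_ordered_cells:
  assumes X: "Hausdorff_space X" and x0: "x0 \<in> topspace X" and n: "n \<ge> 1"
  shows "openin (prefix_domain n X) {u \<in> topspace (prefix_domain n X). u \<in> ordered_cells n X x0}"
proof -
  let ?Z = "prefix_domain n X"
  have xi: "continuous_map ?Z X (\<lambda>u. fst u i)" if "i < n" for i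
    using continuous_map_compose[OF continuous_map_fst continuous_map_product_projection, of i "{..<n}" "\<lambda>_. X"] that
    by (simp add: o_def)
  have ti: "continuous_map ?Z euclideanreal (\<lambda>u. snd u i)" for i
  proof -
    have "continuous_map (simplex_space (n - 1)) euclideanreal (\<lambda>t. t i)"
      by (intro continuous_map_from_subtopology continuous_map_product_projection) simp
    from continuous_map_compose[OF continuous_map_snd this] show ?thesis
      by (simp add: o_def)
  qed
  have cl1: "closedin ?Z {u \<in> topspace ?Z. fst u i = fst u j}" if "i < n" "j < n" for i j
    using closedin_continuous_maps_eq[OF X xi[OF that(1)] xi[OF that(2)]] .
  have cl2: "closedin ?Z {u \<in> topspace ?Z. fst u i = x0}" if "i < n" for i
    using closedin_continuous_maps_eq[OF X xi[OF that], of "\<lambda>_. x0"] x0 by simp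
  have op3: "openin ?Z {u \<in> topspace ?Z. 0 < snd u (n - 1)}"
    using openin_continuous_map_preimage[OF ti, of "{0<..}" "n - 1"] by simp
  let ?C = "(\<Union>(i, j)\<in>{..<n} \<times> {..<n} - Id. {u \<in> topspace ?Z. fst u i = fst u j}) \<union>
     (\<Union>i<n. {u \<in> topspace ?Z. fst u i = x0})"
  have "closedin ?Z ?C"
    using cl1 cl2 by (intro closedin_Un closedin_Union) auto
  then have "openin ?Z ({u \<in> topspace ?Z. 0 < snd u (n - 1)} - ?C)"
    by (rule openin_diff[OF op3])
  moreover have "{u \<in> T. 0 < snd u (n - 1)} - ((\<Union>(i, j)\<in>{..<n} \<times> {..<n} - Id. {u \<in> T. fst u i = fst u j}) \<union>
     (\<Union>i<n. {u \<in> T. fst u i = x0})) = {u \<in> T. u \<in> ordered_cells n X x0}" for T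
    by (auto simp: ordered_cells_def inj_on_def)
  ultimately show ?thesis by (simp only:)
qed

lemma prefix_chain_preimage_top_stratum:
  assumes "n \<ge> 1"
  shows "{u \<in> topspace (prefix_domain n X). (chain_weight \<circ> prefix_chain n) u \<in> top_stratum n X x0} =
    {u \<in> topspace (prefix_domain n X). u \<in> ordered_cells n X x0}"
proof (rule Collect_cong)
  fix u :: "(nat \<Rightarrow> 'a) \<times> (nat \<Rightarrow> real)"
  show "u \<in> topspace (prefix_domain n X) \<and> (chain_weight \<circ> prefix_chain n) u \<in> top_stratum n X x0 \<longleftrightarrow>
      u \<in> topspace (prefix_domain n X) \<and> u \<in> ordered_cells n X x0"
    using prefix_chain_top_stratum_iff[of "fst u" "snd u", OF _ assms]
    by (metis comp_apply prod.collapse)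
qed

lemma top_stratum_subset: "top_stratum n X x0 \<subseteq> topspace (fuzzy_space n X)"
  by (auto simp: top_stratum_def)

lemma openin_top_stratum:
  assumes X: "compact_space X" "Hausdorff_space X" and x0: "x0 \<in> topspace X" and n: "n \<ge> 1"
  shows "openin (fuzzy_space n X) (top_stratum n X x0)"
  using quotient_map_prefix_chain_weight[OF X n, unfolded quotient_map_def, THEN conjunct2, rule_format,
      OF top_stratum_subset, of x0]
    openin_ordered_cells[OF X(2) x0 n]
  unfolding prefix_chain_preimage_top_stratum[OF n] by blast

section \<open>Logarithmic coordinates on the top stratum\<close>

definition thom_domain :: "nat \<Rightarrow> 'a topology \<Rightarrow> ((nat \<Rightarrow> 'a) \<times> (nat \<Rightarrow> real)) topology" where
  "thom_domain n Y = prod_topology (configuration_space Y n) (standard_rep n)"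

lemma topspace_thom_domain:
  "(x, v) \<in> topspace (thom_domain n Y) \<longleftrightarrow>
     x \<in> {..<n} \<rightarrow>\<^sub>E topspace Y \<and> inj_on x {..<n} \<and> v \<in> extensional {..<n} \<and> (\<Sum>i<n. v i) = 0"
  by (auto simp: thom_domain_def configuration_space_def standard_rep_def topspace_product_topology PiE_UNIV_domain PiE_def)

text \<open>\<open>v\<close> is only determined up to the addition of a constant, which is normalised by \<open>max = 0\<close>
  on the side of fuzzy sets and by sum zero in the standard representation.\<close>

definition cell_map :: "nat \<Rightarrow> (nat \<Rightarrow> 'a) \<times> (nat \<Rightarrow> real) \<Rightarrow> 'a \<Rightarrow> real" where
  "cell_map n = (\<lambda>(x, v) a. if a \<in> x ` {..<n} then exp (v (inv_into {..<n} x a) - Max (v ` {..<n})) else 0)"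

lemma cell_map_at:
  assumes "inj_on x {..<n}" "j < n"
  shows "cell_map n (x, v) (x j) = exp (v j - Max (v ` {..<n}))"
  using assms by (simp add: cell_map_def inv_into_f_f)

lemma cell_map_support: "{a. cell_map n (x, v) a \<noteq> 0} = x ` {..<n}"
  by (auto simp: cell_map_def)

lemma cell_map_in_top_stratum:
  assumes u: "(x, v) \<in> topspace (thom_domain n (subtopology X (topspace X - {x0})))" and n: "n \<ge> 1"
  shows "cell_map n (x, v) \<in> top_stratum n X x0"
proof -
  have x: "x i \<in> topspace X" "x i \<noteq> x0" if "i < n" for i
    using u that by (auto simp: topspace_thom_domain)
  have inj: "inj_on x {..<n}"
    using u by (simp add: topspace_thom_domain)
  have M: "v j \<le> Max (v ` {..<n})" if "j < n" for j
    using that by (intro Max_ge) auto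
  have ne: "{..<n} \<noteq> {}"
    using n by (simp add: lessThan_empty_iff)
  then have "Max (v ` {..<n}) \<in> v ` {..<n}"
    by (intro Max_in) auto
  then obtain b where b: "b < n" "Max (v ` {..<n}) = v b"
    by auto
  have 1: "0 \<le> cell_map n (x, v) a \<and> cell_map n (x, v) a \<le> 1" for a
  proof (cases "a \<in> x ` {..<n}")
    case True
    then obtain j where "j < n" "a = x j" by auto
    then show ?thesis using cell_map_at[OF inj] M by simp
  qed (simp add: cell_map_def)
  have 2: "cell_map n (x, v) (x b) = 1"
    using cell_map_at[OF inj b(1)] b(2) by simp
  have "x ` {..<n} \<in> topspace (exp_space n X)"
    using x inj ne by (auto simp: topspace_exp_space card_image)
  then have "cell_map n (x, v) \<in> fuzzy_sets n X"
    using 1 2 by (auto simp: fuzzy_sets_def cell_map_support)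
  moreover have "cell_map n (x, v) x0 = 0"
    using x(2) by (auto simp: cell_map_def)
  ultimately show ?thesis
    using inj by (simp add: top_stratum_def cell_map_support card_image)
qed

text \<open>The inverse of \<open>x\<close> that occurs in \<open>cell_map\<close> is gone here; in
  terms of the ordered entries the pairing is visibly continuous.\<close>

lemma fuzzy_max_cell_map:
  assumes inj: "inj_on x {..<n}" and n: "n \<ge> 1" and \<phi>: "\<And>i. i < n \<Longrightarrow> 0 \<le> \<phi> (x i)"
  shows "fuzzy_max (cell_map n (x, v)) \<phi> = Max ((\<lambda>j. exp (v j - Max (v ` {..<n})) * \<phi> (x j)) ` {..<n})"
proof -
  let ?e = "\<lambda>j. exp (v j - Max (v ` {..<n})) * \<phi> (x j)"
  have "{..<n} \<noteq> {}"
    using n by (simp add: lessThan_empty_iff)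
  then have "Max (?e ` {..<n}) \<in> ?e ` {..<n}"
    by (intro Max_in) auto
  then obtain b where b: "b < n" "Max (?e ` {..<n}) = ?e b"
    by (metis (no_types, lifting) imageE lessThan_iff)
  show ?thesis
  proof (rule fuzzy_max_eqI[where b = "x b"])
    show "finite {a. cell_map n (x, v) a \<noteq> 0}"
      by (simp add: cell_map_support)
    show "cell_map n (x, v) (x b) * \<phi> (x b) = Max (?e ` {..<n})"
      using cell_map_at[OF inj b(1)] b(2) by simp
    fix a show "cell_map n (x, v) a * \<phi> a \<le> Max (?e ` {..<n})"
    proof (cases "a \<in> x ` {..<n}")
      case True
      then obtain j where j: "j < n" "a = x j" by auto
      then have "cell_map n (x, v) a * \<phi> a = ?e j"
        using cell_map_at[OF inj j(1)] by simp
      also have "\<dots> \<le> Max (?e ` {..<n})"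
        using j(1) by (intro Max_ge) auto
      finally show ?thesis .
    next
      case False
      then show ?thesis
        using b \<phi>[OF b(1)] by (simp add: cell_map_def)
    qed
  qed
qed

lemma continuous_map_cell_map:
  assumes n: "n \<ge> 1"
  shows "continuous_map (thom_domain n (subtopology X (topspace X - {x0})))
    (subtopology (fuzzy_space n X) (top_stratum n X x0)) (cell_map n)"
  unfolding continuous_map_in_subtopology
proof
  let ?Y = "subtopology X (topspace X - {x0})"
  let ?Z = "thom_domain n ?Y"
  show W: "cell_map n \<in> topspace ?Z \<rightarrow> top_stratum n X x0"
    using cell_map_in_top_stratum[OF _ n] by (auto simp del: subtopology_topspace)
  have xi: "continuous_map ?Z X (\<lambda>u. fst u i)" if "i < n" for i
  proof -
    have "continuous_map (configuration_space ?Y n) ?Y (\<lambda>x. x i)"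
      unfolding configuration_space_def using that
      by (intro continuous_map_from_subtopology continuous_map_product_projection) simp
    then have "continuous_map (configuration_space ?Y n) X (\<lambda>x. x i)"
      by (rule continuous_map_into_fulltopology)
    from continuous_map_compose[OF continuous_map_fst this] show ?thesis
      by (simp add: o_def thom_domain_def)
  qed
  have vi: "continuous_map ?Z euclideanreal (\<lambda>u. snd u i)" if "i < n" for i
  proof -
    have "continuous_map (standard_rep n) euclideanreal (\<lambda>t. t i)"
      unfolding standard_rep_def using that
      by (intro continuous_map_from_subtopology continuous_map_product_projection) simp
    from continuous_map_compose[OF continuous_map_snd this] show ?thesis
      by (simp add: o_def thom_domain_def)
  qed
  have ne: "{..<n} \<noteq> {}"
    using n by (simp add: lessThan_empty_iff)
  show "continuous_map ?Z (fuzzy_space n X) (cell_map n)"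
  proof (rule continuous_map_into_fuzzy_space)
    show "cell_map n u \<in> fuzzy_sets n X" if "u \<in> topspace ?Z" for u
      using W that by (auto simp: top_stratum_def)
    fix \<phi> assume \<phi>: "\<phi> \<in> test_functions X"
    have "continuous_map ?Z euclideanreal (\<lambda>u. snd u j - Max ((\<lambda>i. snd u i) ` {..<n}))" if "j < n" for j
      using that vi ne by (intro continuous_map_diff continuous_map_Max) auto
    from continuous_map_compose[OF this, of _ euclideanreal exp]
    have e: "continuous_map ?Z euclideanreal (\<lambda>u. exp (snd u j - Max ((\<lambda>i. snd u i) ` {..<n})))" if "j < n" for j
      using that by (simp add: o_def continuous_on_exp)
    have p: "continuous_map ?Z euclideanreal (\<lambda>u. \<phi> (fst u j))" if "j < n" for j
      using continuous_map_compose[OF xi[OF that], of euclideanreal \<phi>] \<phi>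
      by (simp add: o_def test_functions_def)
    have "continuous_map ?Z euclideanreal
        (\<lambda>u. Max ((\<lambda>j. exp (snd u j - Max ((\<lambda>i. snd u i) ` {..<n})) * \<phi> (fst u j)) ` {..<n}))"
      using ne by (intro continuous_map_Max continuous_map_real_mult e p) auto
    then show "continuous_map ?Z euclideanreal (\<lambda>u. fuzzy_max (cell_map n u) \<phi>)"
    proof (rule continuous_map_eq)
      fix u assume "u \<in> topspace ?Z"
      then have u: "(fst u, snd u) \<in> topspace ?Z" by simp
      then have "inj_on (fst u) {..<n}" "\<And>i. i < n \<Longrightarrow> 0 \<le> \<phi> (fst u i)"
        using \<phi> unfolding topspace_thom_domain by (auto simp: test_functions_def PiE_iff)
      from fuzzy_max_cell_map[where \<phi> = \<phi>, OF this(1) n this(2), of "snd u"]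
      show "Max ((\<lambda>j. exp (snd u j - Max ((\<lambda>i. snd u i) ` {..<n})) * \<phi> (fst u j)) ` {..<n}) =
          fuzzy_max (cell_map n u) \<phi>"
        by simp
    qed
  qed
qed

text \<open>Logarithms of the tail sums, which are the weights of the entries, recentred by their
  mean to reach the sum-zero hyperplane. The vectors are weakly decreasing, so only one chamber of
  the representation is reached; this still lifts the parametrisation of the top stratum through
  \<open>cell_map\<close>.\<close>

definition cell_coordinates :: "nat \<Rightarrow> (nat \<Rightarrow> 'a) \<times> (nat \<Rightarrow> real) \<Rightarrow> (nat \<Rightarrow> 'a) \<times> (nat \<Rightarrow> real)" where
  "cell_coordinates n = (\<lambda>(x, t). (x, \<lambda>j\<in>{..<n}.
     ln (sum t {j..n - 1}) - (\<Sum>i<n. ln (sum t {i..n - 1})) / real n))"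

lemma tail_sum_pos:
  fixes t :: "nat \<Rightarrow> real"
  assumes "\<And>i. 0 \<le> t i" "0 < t (n - 1)" "j < n"
  shows "0 < sum t {j..n - 1}"
proof -
  have "t (n - 1) \<le> sum t {j..n - 1}"
    using assms by (intro member_le_sum) auto
  then show ?thesis using assms(2) by simp
qed

lemma cell_coordinates_in_thom_domain:
  assumes u: "(x, t) \<in> topspace (prefix_domain n X)" "(x, t) \<in> ordered_cells n X x0" and n: "n \<ge> 1"
  shows "cell_coordinates n (x, t) \<in> topspace (thom_domain n (subtopology X (topspace X - {x0})))"
  using assms
  by (auto simp: cell_coordinates_def topspace_thom_domain ordered_cells_def topspace_product_topology
      sum_subtractf PiE_iff)

text \<open>The largest tail is the one from 0 and equals 1, so the maximal entry of the vector is
  minus the mean of the logarithms, and the normalisation by \<open>Max\<close> undoes the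
  recentring.\<close>

lemma cell_map_cell_coordinates:
  assumes u: "(x, t) \<in> topspace (prefix_domain n X)" "(x, t) \<in> ordered_cells n X x0" and n: "n \<ge> 1"
  shows "cell_map n (cell_coordinates n (x, t)) = chain_weight (prefix_chain n (x, t))"
proof
  fix a
  let ?\<tau> = "\<lambda>j. sum t {j..n - 1}"
  let ?m = "(\<Sum>i<n. ln (?\<tau> i)) / real n"
  let ?v = "\<lambda>j\<in>{..<n}. ln (?\<tau> j) - ?m"
  have inj: "inj_on x {..<n}" and tn: "0 < t (n - 1)"
    using u(2) by (simp_all add: ordered_cells_def)
  have t0: "\<And>i. 0 \<le> t i" and t1: "sum t {..n - 1} = 1"
    using u(1) by (auto simp: standard_simplex_def)
  have pos: "0 < ?\<tau> j" if "j < n" for j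
    using t0 tn that by (rule tail_sum_pos)
  have \<tau>0: "?\<tau> 0 = 1"
    using t1 by (simp add: atMost_atLeast0)
  have "?\<tau> j \<le> 1" for j
    unfolding \<tau>0[symmetric] using t0 by (intro sum_mono2) auto
  then have "ln (?\<tau> j) \<le> 0" if "j < n" for j
    using pos[OF that] by simp
  then have M: "Max (?v ` {..<n}) = - ?m"
    using n \<tau>0 by (intro Max_eqI) (auto intro!: image_eqI[of _ _ 0])
  show "cell_map n (cell_coordinates n (x, t)) a = chain_weight (prefix_chain n (x, t)) a"
  proof (cases "a \<in> x ` {..<n}")
    case True
    then obtain j where j: "j < n" "a = x j" by auto
    have "cell_map n (x, ?v) (x j) = exp (?v j - Max (?v ` {..<n}))"
      using cell_map_at[OF inj j(1)] .
    also have "\<dots> = ?\<tau> j"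
      unfolding M using j(1) pos[OF j(1)] by simp
    finally show ?thesis
      using prefix_chain_weight_eq[OF inj j(1), of t] j(2) by (simp add: cell_coordinates_def)
  next
    case False
    then have "chain_weight (prefix_chain n (x, t)) a = 0"
      using prefix_chain_weight_support[OF n, of x t] by blast
    then show ?thesis
      using False by (simp add: cell_coordinates_def cell_map_def)
  qed
qed

lemma continuous_map_real_ln:
  assumes "continuous_map Z euclideanreal f" "\<And>z. z \<in> topspace Z \<Longrightarrow> f z > 0"
  shows "continuous_map Z euclideanreal (\<lambda>z. ln (f z))"
  unfolding continuous_map_atin
proof
  fix z assume "z \<in> topspace Z"
  then show "limitin euclideanreal (\<lambda>z. ln (f z)) (ln (f z)) (atin Z z)"
    using assms(1) assms(2)[of z] by (simp add: continuous_map_atin tendsto_ln)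
qed

lemma continuous_map_cell_coordinates:
  assumes n: "n \<ge> 1"
  shows "continuous_map (subtopology (prefix_domain n X) {u \<in> topspace (prefix_domain n X). u \<in> ordered_cells n X x0})
    (thom_domain n (subtopology X (topspace X - {x0}))) (cell_coordinates n)" (is "continuous_map ?U _ _")
proof -
  let ?Y = "subtopology X (topspace X - {x0})"
  have U: "(fst u, snd u) \<in> topspace (prefix_domain n X)" "(fst u, snd u) \<in> ordered_cells n X x0"
    if "u \<in> topspace ?U" for u
    using that by auto
  have img: "cell_coordinates n u \<in> topspace (thom_domain n ?Y)" if "u \<in> topspace ?U" for u
    using cell_coordinates_in_thom_domain[OF U[OF that] n] by simp
  have xi: "continuous_map ?U X (\<lambda>u. fst u i)" if "i < n" for i
    using continuous_map_from_subtopology[OF continuous_map_compose[OF continuous_map_fst continuous_map_product_projection, of i "{..<n}" "\<lambda>_. X"]] that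
    by (simp add: o_def)
  have ti: "continuous_map ?U euclideanreal (\<lambda>u. snd u i)" for i
  proof -
    have "continuous_map (simplex_space (n - 1)) euclideanreal (\<lambda>t. t i)"
      by (intro continuous_map_from_subtopology continuous_map_product_projection) simp
    from continuous_map_from_subtopology[OF continuous_map_compose[OF continuous_map_snd this]] show ?thesis
      by (simp add: o_def)
  qed
  have lni: "continuous_map ?U euclideanreal (\<lambda>u. ln (sum (snd u) {j..n - 1}))" if "j < n" for j
  proof (rule continuous_map_real_ln)
    show "continuous_map ?U euclideanreal (\<lambda>u. sum (snd u) {j..n - 1})"
      by (intro continuous_map_sum ti) simp
    fix u assume "u \<in> topspace ?U"
    from U[OF this] show "0 < sum (snd u) {j..n - 1}"
      using that by (intro tail_sum_pos) (auto simp: standard_simplex_def ordered_cells_def)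
  qed
  have c1: "continuous_map ?U (configuration_space ?Y n) fst"
    unfolding configuration_space_def continuous_map_in_subtopology continuous_map_componentwise
  proof (intro conjI ballI)
    have *: "fst u \<in> {..<n} \<rightarrow>\<^sub>E topspace ?Y \<and> inj_on (fst u) {..<n}" if "u \<in> topspace ?U" for u
      using img[OF that] topspace_thom_domain[of "fst u" "snd (cell_coordinates n u)" n ?Y]
      by (simp add: cell_coordinates_def case_prod_unfold)
    show "fst ` topspace ?U \<subseteq> extensional {..<n}"
    proof (rule image_subsetI)
      fix u assume "u \<in> topspace ?U"
      from *[OF this] show "fst u \<in> extensional {..<n}"
        by (simp add: PiE_iff)
    qed
    show "fst \<in> topspace ?U \<rightarrow> {x. inj_on x {..<n}}"
    proof (rule funcsetI)
      fix u assume "u \<in> topspace ?U"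
      from *[OF this] show "fst u \<in> {x. inj_on x {..<n}}"
        by simp
    qed
    fix i assume i: "i \<in> {..<n}"
    show "continuous_map ?U X (\<lambda>u. fst u i)"
      using xi i by simp
    show "(\<lambda>u. fst u i) \<in> topspace ?U \<rightarrow> topspace X - {x0}"
    proof (rule funcsetI)
      fix u assume "u \<in> topspace ?U"
      then have "fst u i \<in> topspace ?Y"
        using *[of u] i by (auto simp: PiE_iff)
      then show "fst u i \<in> topspace X - {x0}" by simp
    qed
  qed
  have c2: "continuous_map ?U (standard_rep n) (\<lambda>u. snd (cell_coordinates n u))"
    unfolding standard_rep_def continuous_map_in_subtopology continuous_map_componentwise
  proof (intro conjI ballI)
    show "(\<lambda>u. snd (cell_coordinates n u)) ` topspace ?U \<subseteq> extensional {..<n}"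
      by (intro image_subsetI) (simp add: cell_coordinates_def case_prod_unfold)
    show "(\<lambda>u. snd (cell_coordinates n u)) \<in> topspace ?U \<rightarrow> {v. (\<Sum>i<n. v i) = 0}"
    proof (rule funcsetI)
      fix u assume "u \<in> topspace ?U"
      from img[OF this] show "snd (cell_coordinates n u) \<in> {v. (\<Sum>i<n. v i) = 0}"
        using topspace_thom_domain[of "fst (cell_coordinates n u)" "snd (cell_coordinates n u)" n ?Y] by simp
    qed
    fix j assume "j \<in> {..<n}"
    have "continuous_map ?U euclideanreal (\<lambda>u. \<Sum>i<n. ln (sum (snd u) {i..n - 1}))"
      by (rule continuous_map_sum[OF finite_lessThan lni]) simp
    then have "continuous_map ?U euclideanreal (\<lambda>u. (\<Sum>i<n. ln (sum (snd u) {i..n - 1})) / real n)"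
      using n by (intro continuous_map_real_divide) simp_all
    then have "continuous_map ?U euclideanreal
        (\<lambda>u. ln (sum (snd u) {j..n - 1}) - (\<Sum>i<n. ln (sum (snd u) {i..n - 1})) / real n)"
      using lni[of j] \<open>j \<in> {..<n}\<close> by (intro continuous_map_diff) simp_all
    moreover have "ln (sum (snd u) {j..n - 1}) - (\<Sum>i<n. ln (sum (snd u) {i..n - 1})) / real n =
        snd (cell_coordinates n u) j" for u :: "(nat \<Rightarrow> 'a) \<times> (nat \<Rightarrow> real)"
      using \<open>j \<in> {..<n}\<close> by (simp add: cell_coordinates_def case_prod_unfold)
    ultimately show "continuous_map ?U euclideanreal (\<lambda>u. snd (cell_coordinates n u) j)"
      by (simp only:)
  qed
  have "continuous_map ?U (thom_domain n ?Y) (\<lambda>u. (fst u, snd (cell_coordinates n u)))"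
    unfolding thom_domain_def using c1 c2 by (rule continuous_map_pairedI)
  moreover have "(fst u, snd (cell_coordinates n u)) = cell_coordinates n u" for u :: "(nat \<Rightarrow> 'a) \<times> (nat \<Rightarrow> real)"
    by (simp add: cell_coordinates_def case_prod_unfold)
  ultimately show ?thesis
    by (simp only:)
qed

text \<open>The domain need not be compact, so the property is inherited: composed with
  \<open>cell_coordinates\<close> the map becomes the restriction of a quotient map to the preimage
  of an open set, and a continuous second factor of a quotient map is a quotient map.\<close>

lemma quotient_map_cell_map:
  assumes X: "compact_space X" "Hausdorff_space X" and x0: "x0 \<in> topspace X" and n: "n \<ge> 1"
  shows "quotient_map (thom_domain n (subtopology X (topspace X - {x0})))
    (subtopology (fuzzy_space n X) (top_stratum n X x0)) (cell_map n)"
proof (rule quotient_map_from_composition)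
  let ?V = "{u \<in> topspace (prefix_domain n X). u \<in> ordered_cells n X x0}"
  let ?U = "subtopology (prefix_domain n X) ?V"
  show "continuous_map ?U (thom_domain n (subtopology X (topspace X - {x0}))) (cell_coordinates n)"
    using n by (rule continuous_map_cell_coordinates)
  show "continuous_map (thom_domain n (subtopology X (topspace X - {x0})))
    (subtopology (fuzzy_space n X) (top_stratum n X x0)) (cell_map n)"
    using n by (rule continuous_map_cell_map)
  have "quotient_map ?U (subtopology (fuzzy_space n X) (top_stratum n X x0)) (chain_weight \<circ> prefix_chain n)"
    using quotient_map_prefix_chain_weight[OF X n] prefix_chain_preimage_top_stratum[OF n]
      disjI1[OF openin_top_stratum[OF X x0 n]]
    by (rule quotient_map_restriction)
  then show "quotient_map ?U (subtopology (fuzzy_space n X) (top_stratum n X x0)) (cell_map n \<circ> cell_coordinates n)"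
  proof (rule quotient_map_eq)
    fix u assume "u \<in> topspace ?U"
    then have "(fst u, snd u) \<in> topspace (prefix_domain n X)" "(fst u, snd u) \<in> ordered_cells n X x0"
      by auto
    from cell_map_cell_coordinates[OF this n]
    show "(chain_weight \<circ> prefix_chain n) u = (cell_map n \<circ> cell_coordinates n) u"
      by simp
  qed
qed

section \<open>Orbits of the symmetric group\<close>

lemma thom_rel_sym:
  assumes "thom_rel n p q"
  shows "thom_rel n q p"
proof -
  obtain \<pi> where \<pi>: "\<pi> permutes {..<n}" and eq: "fst q = fst p \<circ> \<pi>" "snd q = snd p \<circ> \<pi>"
    using assms unfolding thom_rel_def by blast
  have "fst p = fst q \<circ> inv_into UNIV \<pi>" "snd p = snd q \<circ> inv_into UNIV \<pi>"
    unfolding eq comp_assoc permutes_inv_o(1)[OF \<pi>] by simp_all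
  with permutes_inv[OF \<pi>] show ?thesis
    unfolding thom_rel_def by (intro exI[of _ "inv_into UNIV \<pi>"] conjI)
qed

lemma thom_rel_trans:
  assumes "thom_rel n p q" "thom_rel n q r"
  shows "thom_rel n p r"
proof -
  obtain \<pi> where \<pi>: "\<pi> permutes {..<n}" and q: "fst q = fst p \<circ> \<pi>" "snd q = snd p \<circ> \<pi>"
    using assms(1) unfolding thom_rel_def by blast
  obtain \<rho> where \<rho>: "\<rho> permutes {..<n}" and r: "fst r = fst q \<circ> \<rho>" "snd r = snd q \<circ> \<rho>"
    using assms(2) unfolding thom_rel_def by blast
  have "fst r = fst p \<circ> (\<pi> \<circ> \<rho>)" "snd r = snd p \<circ> (\<pi> \<circ> \<rho>)"
    unfolding q r by (simp_all only: comp_assoc)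
  with permutes_compose[OF \<rho> \<pi>] show ?thesis
    unfolding thom_rel_def by (intro exI[of _ "\<pi> \<circ> \<rho>"] conjI)
qed

text \<open>Orbits of a group already form an equivalence relation, so the closure in the quotient
  construction adds no identifications.\<close>

lemma equivclp_thom_rel: "equivclp (thom_rel n) p q \<longleftrightarrow> thom_rel n p q"
proof
  assume "equivclp (thom_rel n) p q"
  then show "thom_rel n p q"
  proof (induction rule: equivclp_induct)
    case base
    show ?case
      unfolding thom_rel_def by (intro exI[of _ id]) (simp add: permutes_id)
  next
    case (step q r)
    then show ?case
      using thom_rel_sym thom_rel_trans by metis
  qed
qed (rule r_into_equivclp)

text \<open>Equal supports yield a permutation matching the entries. Equal values match the vectors
  up to the difference of the two maxima, a constant that vanishes because both vectors sum to
  zero.\<close>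

lemma cell_map_eq_iff:
  assumes u: "(x, v) \<in> topspace (thom_domain n Y)" and w: "(y, w) \<in> topspace (thom_domain n Y)" and n: "n \<ge> 1"
  shows "cell_map n (x, v) = cell_map n (y, w) \<longleftrightarrow> thom_rel n (x, v) (y, w)"
proof
  have ix: "inj_on x {..<n}" and iy: "inj_on y {..<n}"
    and sv: "(\<Sum>i<n. v i) = 0" and sw: "(\<Sum>i<n. w i) = 0"
    and ev: "v \<in> extensional {..<n}" and ew: "w \<in> extensional {..<n}"
    and ex: "x \<in> extensional {..<n}" and ey: "y \<in> extensional {..<n}"
    using topspace_thom_domain[THEN iffD1, OF u] topspace_thom_domain[THEN iffD1, OF w]
    unfolding PiE_iff by simp_all
  let ?M = "Max (v ` {..<n})" and ?N = "Max (w ` {..<n})"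
  {
    assume eq: "cell_map n (x, v) = cell_map n (y, w)"
    have im: "x ` {..<n} = y ` {..<n}"
      using cell_map_support[of n x v] cell_map_support[of n y w] unfolding eq by (rule trans[OF sym])
    \<comment> \<open>Beyond \<open>n\<close> the identity is what \<open>permutes\<close> requires,
      and it respects the value \<open>undefined\<close> of the functions there.\<close>
    define \<pi> where "\<pi> j = (if j < n then inv_into {..<n} x (y j) else j)" for j
    have x\<pi>: "\<pi> j < n" "x (\<pi> j) = y j" if "j < n" for j
    proof -
      have "y j \<in> x ` {..<n}"
        unfolding im using that by simp
      then show "\<pi> j < n" "x (\<pi> j) = y j"
        using that inv_into_into[of "y j" x "{..<n}"] by (simp_all add: \<pi>_def f_inv_into_f)
    qed
    have inj: "inj_on \<pi> {..<n}"
    proof (rule inj_onI)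
      fix i j assume "i \<in> {..<n}" "j \<in> {..<n}" "\<pi> i = \<pi> j"
      then show "i = j"
        using x\<pi>(2)[of i] x\<pi>(2)[of j] inj_onD[OF iy] by simp
    qed
    have "bij_betw \<pi> {..<n} {..<n}"
      using inj x\<pi>(1) by (intro bij_betw_imageI endo_inj_surj) auto
    then have perm: "\<pi> permutes {..<n}"
      by (rule bij_imp_permutes) (simp add: \<pi>_def)
    have val: "v (\<pi> j) = w j + (?M - ?N)" if "j < n" for j
    proof -
      have "exp (v (\<pi> j) - ?M) = exp (w j - ?N)"
        using cell_map_at[OF ix x\<pi>(1)[OF that], of v] cell_map_at[OF iy that, of w] x\<pi>(2)[OF that] eq by simp
      then show ?thesis by simp
    qed
    have "(\<Sum>j<n. v (\<pi> j)) = (\<Sum>j<n. v j)"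
      using sum.permute[OF perm, of v] by (simp add: o_def)
    then have "(\<Sum>j<n. w j + (?M - ?N)) = 0"
      using val sv by simp
    then have "?M = ?N"
      using sw n by (simp add: sum.distrib)
    then have "w j = v (\<pi> j)" for j
      using val[of j] ev ew by (cases "j < n") (simp_all add: \<pi>_def extensional_def)
    moreover have "y j = x (\<pi> j)" for j
      using x\<pi>(2)[of j] ex ey by (cases "j < n") (simp_all add: \<pi>_def extensional_def)
    ultimately show "thom_rel n (x, v) (y, w)"
      unfolding thom_rel_def using perm by (intro exI[of _ \<pi>]) (simp add: fun_eq_iff)
  }
  assume "thom_rel n (x, v) (y, w)"
  then obtain \<pi> where perm: "\<pi> permutes {..<n}" and y: "y = x \<circ> \<pi>" and wv: "w = v \<circ> \<pi>"
    by (auto simp: thom_rel_def)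
  have im: "\<pi> ` {..<n} = {..<n}"
    using perm by (rule permutes_image)
  have imy: "y ` {..<n} = x ` {..<n}" and imw: "w ` {..<n} = v ` {..<n}"
    by (simp_all only: y wv image_comp[symmetric] im)
  show "cell_map n (x, v) = cell_map n (y, w)"
  proof
    fix a
    show "cell_map n (x, v) a = cell_map n (y, w) a"
    proof (cases "a \<in> y ` {..<n}")
      case True
      then obtain j where j: "j < n" "a = y j" by auto
      have "\<pi> j < n"
        using im j(1) by blast
      then show ?thesis
        using cell_map_at[OF ix, of "\<pi> j" v] cell_map_at[OF iy j(1), of w] j(2) imw by (simp add: y wv)
    next
      case False
      then show ?thesis
        by (simp add: cell_map_def imy[symmetric])
    qed
  qed
qed

lemma top_stratum_homeomorphic_thom_bundle:
  assumes X: "compact_space X" "Hausdorff_space X" and x0: "x0 \<in> topspace X" and n: "n \<ge> 1"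
  obtains p where "homeomorphic_map (subtopology (fuzzy_space n X) (top_stratum n X x0))
    (thom_bundle n (subtopology X (topspace X - {x0}))) p"
proof -
  let ?Z = "thom_domain n (subtopology X (topspace X - {x0}))"
  have q: "quotient_map ?Z (thom_bundle n (subtopology X (topspace X - {x0}))) (quotient_class ?Z (thom_rel n))"
    unfolding thom_bundle_def thom_domain_def by (rule quotient_map_quotient_class)
  show thesis
  proof (rule quotient_maps_homeomorphic[OF quotient_map_cell_map[OF X x0 n] q])
    fix u w assume "u \<in> topspace ?Z" "w \<in> topspace ?Z"
    then show "cell_map n u = cell_map n w \<longleftrightarrow> quotient_class ?Z (thom_rel n) u = quotient_class ?Z (thom_rel n) w"
      using cell_map_eq_iff[of "fst u" "snd u" n _ "fst w" "snd w", OF _ _ n]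
      by (simp add: quotient_class_eq_iff equivclp_thom_rel)
  qed (rule that)
qed


section \<open>The subcomplex of non-complements\<close>

text \<open>The meet is bottom when \<open>x0\<close> is not in \<open>A\<close>. The join is top
  when no member of the poset contains both \<open>A\<close> and \<open>x0\<close>, which for
  \<open>x0\<close> outside \<open>A\<close> means that \<open>A\<close> already has
  \<open>n\<close> points.\<close>

lemma exp_complements_eq:
  assumes x0: "x0 \<in> topspace X" and n: "n \<ge> 1"
  shows "exp_complements n X x0 = {A \<in> topspace (exp_space n X). card A = n \<and> x0 \<notin> A}"
proof -
  let ?P = "topspace (exp_space n X)"
  let ?L = "hat_order ?P (\<subseteq>)"
  interpret L: lattice ?L
    by (rule lattice_hat_exp_space)
  have s: "{x0} \<in> ?P"
    using x0 n by (simp add: topspace_exp_space)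
  have "least ?L Zero_hat (carrier ?L)"
    by (simp add: least_def)
  then have "\<bottom>\<^bsub>?L\<^esub> = Zero_hat"
    unfolding bottom_def by (metis (mono_tags, lifting) L.least_unique someI)
  have "greatest ?L One_hat (carrier ?L)"
    by (simp add: greatest_def hat_le_One)
  then have "\<top>\<^bsub>?L\<^esub> = One_hat"
    unfolding top_def by (metis (mono_tags, lifting) L.greatest_unique someI)
  have "In_hat A \<in> complements ?L (In_hat {x0}) \<longleftrightarrow> card A = n \<and> x0 \<notin> A" if A: "A \<in> ?P" for A
  proof -
    have A': "finite A" "A \<noteq> {}" "card A \<le> n" "A \<subseteq> topspace X"
      using A by (simp_all add: topspace_exp_space)
    have cA: "In_hat A \<in> carrier ?L" and cs: "In_hat {x0} \<in> carrier ?L"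
      using A s by simp_all
    let ?m = "In_hat A \<sqinter>\<^bsub>?L\<^esub> In_hat {x0}" and ?j = "In_hat A \<squnion>\<^bsub>?L\<^esub> In_hat {x0}"
    have m: "?m \<in> carrier ?L" "hat_le (\<subseteq>) ?m (In_hat A)" "hat_le (\<subseteq>) ?m (In_hat {x0})"
      using L.meet_closed[OF cA cs] L.meet_left[OF cA cs] L.meet_right[OF cA cs] by simp_all
    have j: "?j \<in> carrier ?L" "hat_le (\<subseteq>) (In_hat A) ?j" "hat_le (\<subseteq>) (In_hat {x0}) ?j"
      using L.join_closed[OF cA cs] L.join_left[OF cA cs] L.join_right[OF cA cs] by simp_all
    have meet: "?m = Zero_hat \<longleftrightarrow> x0 \<notin> A"
    proof
      assume "?m = Zero_hat"
      moreover have "hat_le (\<subseteq>) (In_hat {x0}) ?m" if "x0 \<in> A"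
        using L.meet_le[of "In_hat {x0}" "In_hat A" "In_hat {x0}"] s that A by (simp add: hat_le_refl)
      ultimately show "x0 \<notin> A" by fastforce
    next
      assume "x0 \<notin> A"
      then show "?m = Zero_hat"
        using m by (cases ?m) (auto simp: topspace_exp_space subset_singleton_iff)
    qed
    have join: "?j = One_hat \<longleftrightarrow> card A = n" if "x0 \<notin> A"
    proof
      assume "?j = One_hat"
      moreover have "hat_le (\<subseteq>) ?j (In_hat (insert x0 A))" if "insert x0 A \<in> ?P"
        using L.join_le[OF _ _ cA cs, of "In_hat (insert x0 A)"] that by auto
      ultimately have "insert x0 A \<notin> ?P" by auto
      then show "card A = n"
        using A' x0 \<open>x0 \<notin> A\<close> by (simp add: topspace_exp_space)
    next
      assume c: "card A = n"
      show "?j = One_hat"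
      proof (cases ?j)
        case (In_hat B)
        then have B: "A \<subseteq> B" "x0 \<in> B" "B \<in> ?P"
          using j by auto
        then have "card (insert x0 A) \<le> card B" "card B \<le> n"
          by (auto simp: topspace_exp_space intro!: card_mono)
        then show ?thesis
          using c A'(1) \<open>x0 \<notin> A\<close> by simp
      qed (use j in auto)
    qed
    show ?thesis
      unfolding complements_def \<open>\<bottom>\<^bsub>?L\<^esub> = Zero_hat\<close> \<open>\<top>\<^bsub>?L\<^esub> = One_hat\<close>
      using cA meet join by blast
  qed
  then show ?thesis
    unfolding exp_complements_def by blast
qed

section \<open>The inclusion of the subcomplex and its image\<close>

lemma equivclp_realization_rel_mono:
  assumes N: "\<And>k. topspace (N k) \<subseteq> topspace (N' k)"
    and "equivclp (realization_rel N d s) z w"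
  shows "equivclp (realization_rel N' d s) z w"
proof -
  have mono: "realization_rel N' d s z w" if "realization_rel N d s z w" for z w
    using that
  proof cases
    case (face x k i t)
    then show ?thesis using N by (auto intro: realization_rel.face)
  next
    case (degen x k i t)
    then show ?thesis using N by (auto intro: realization_rel.degen)
  qed
  show ?thesis
    using assms(2)
  proof (induction rule: equivclp_induct)
    case (step y z)
    then show ?case
      using mono by (meson equivclp_into_equivclp)
  qed simp
qed

text \<open>The inclusion is defined as a union over representatives. Relations over the subposet
  are relations over \<open>P\<close>, so all representatives have one class in the large complex
  and the union is that class.\<close>

lemma order_complex_inclusion_class:
  assumes z: "z \<in> topspace (realization_sum (chain_space (subtopology P S) leq))"
  shows "order_complex_inclusion P leq (order_complex_class (subtopology P S) leq z) = order_complex_class P leq z"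
proof -
  let ?N = "chain_space (subtopology P S) leq" and ?N' = "chain_space P leq"
  have N: "topspace (?N k) \<subseteq> topspace (?N' k)" for k
    by (auto simp: topspace_chain_space PiE_iff)
  then have S: "topspace (realization_sum ?N) \<subseteq> topspace (realization_sum ?N')"
    by (auto simp: topspace_realization_sum intro: subsetD[OF N])
  have "order_complex_class P leq w = order_complex_class P leq z"
    if "w \<in> order_complex_class (subtopology P S) leq z" for w
  proof -
    have w: "w \<in> topspace (realization_sum ?N)" "equivclp (realization_rel ?N chain_face chain_degen) z w"
      using that by (simp_all add: order_complex_class_def quotient_class_def)
    have "equivclp (realization_rel ?N' chain_face chain_degen) w z"
      using equivclp_realization_rel_mono[OF N w(2)] by (rule equivclp_sym)
    then show ?thesis
      unfolding order_complex_class_def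
      using quotient_class_eq_iff[OF subsetD[OF S w(1)] subsetD[OF S z]] by blast
  qed
  moreover have "z \<in> order_complex_class (subtopology P S) leq z"
    using z by (simp add: order_complex_class_def quotient_class_def)
  ultimately show ?thesis
    unfolding order_complex_inclusion_def order_complex_class_def[symmetric] by blast
qed

lemma top_stratum_iff:
  assumes "f \<in> fuzzy_sets n X"
  shows "f \<in> top_stratum n X x0 \<longleftrightarrow> \<not> (x0 \<in> {a. f a \<noteq> 0} \<or> card {a. f a \<noteq> 0} < n)"
  using fuzzy_setsD(5)[OF assms] assms by (auto simp: top_stratum_def)

text \<open>The support of the weight is the member at the last nonzero coordinate, and as an
  element of \<open>R\<close> it contains \<open>x0\<close> or does not have \<open>n\<close>
  points.\<close>

lemma chain_weight_subcomplex:
  assumes x0: "x0 \<in> topspace X" and n: "n \<ge> 1"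
    and R: "R = subtopology (exp_space n X) (topspace (exp_space n X) - exp_complements n X x0)"
    and z: "z \<in> topspace (realization_sum (chain_space R (\<subseteq>)))"
  shows "z \<in> topspace (realization_sum (chain_space (exp_space n X) (\<subseteq>)))"
    and "chain_weight z \<notin> top_stratum n X x0"
proof -
  obtain k A t where zk: "z = (k, A, t)"
    by (cases z)
  have A: "A \<in> {..k} \<rightarrow>\<^sub>E topspace R" "\<forall>i<k. A i \<subseteq> A (Suc i)" and t: "t \<in> standard_simplex k"
    using z by (simp_all add: zk topspace_realization_sum topspace_chain_space)
  show zP: "z \<in> topspace (realization_sum (chain_space (exp_space n X) (\<subseteq>)))"
    using A t by (auto simp: zk R topspace_realization_sum topspace_chain_space PiE_iff)
  let ?S = "{a. chain_weight z a \<noteq> 0}"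
  have f: "chain_weight z \<in> fuzzy_sets n X"
    using chain_weight_in_fuzzy_sets zP by (simp add: zk)
  have t0: "\<And>i. 0 \<le> t i" "sum t {..k} = 1"
    using t by (auto simp: standard_simplex_def)
  have Ri: "A i \<in> topspace (exp_space n X)" "card (A i) \<noteq> n \<or> x0 \<in> A i" if "i \<le> k" for i
  proof -
    have "A i \<in> topspace R" using A(1) that by auto
    then show "A i \<in> topspace (exp_space n X)" "card (A i) \<noteq> n \<or> x0 \<in> A i"
      unfolding R by (auto simp: exp_complements_eq[OF x0 n])
  qed
  \<comment> \<open>The chain may be degenerate, so \<open>i\<close> can be smaller than
    \<open>k\<close>; members beyond \<open>i\<close> add nothing to the support.\<close>
  define i where "i = Max {i. i \<le> k \<and> t i \<noteq> 0}"
  have ne: "{i. i \<le> k \<and> t i \<noteq> 0} \<noteq> {}"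
  proof
    assume "{i. i \<le> k \<and> t i \<noteq> 0} = {}"
    then have "sum t {..k} = 0"
      by (intro sum.neutral) auto
    then show False using t0(2) by simp
  qed
  have "i \<in> {i. i \<le> k \<and> t i \<noteq> 0}"
    unfolding i_def using ne by (intro Max_in) auto
  then have i: "i \<le> k" "t i > 0"
    using t0(1)[of i] by auto
  have after: "t j = 0" if "j \<le> k" "i < j" for j
  proof (rule ccontr)
    assume "t j \<noteq> 0"
    then have "j \<le> i"
      unfolding i_def using that by (intro Max_ge) auto
    then show False using that by simp
  qed
  have "?S = A i"
  proof
    show "?S \<subseteq> A i"
    proof
      fix a assume "a \<in> ?S"
      then have "(\<Sum>j\<le>k. of_bool (a \<in> A j) * t j) \<noteq> 0"
        by (simp add: zk chain_weight_def)
      then obtain j where j: "j \<le> k" "of_bool (a \<in> A j) * t j \<noteq> 0"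
        by (meson atMost_iff sum.neutral)
      then have "a \<in> A j" "t j \<noteq> 0"
        by auto
      then have "j \<le> i"
        using after[OF j(1)] by (meson not_le)
      with \<open>a \<in> A j\<close> show "a \<in> A i"
        using chain_mono[OF A(2), of j i] i(1) by blast
    qed
    show "A i \<subseteq> ?S"
    proof
      fix a assume "a \<in> A i"
      then have "sum t {i..k} \<le> chain_weight z a"
        unfolding zk by (intro chain_weight_ge_tail[OF A(2) i(1)] t0(1))
      moreover have "t i \<le> sum t {i..k}"
        using i(1) t0(1) by (intro member_le_sum) auto
      ultimately show "a \<in> ?S"
        using i(2) by simp
    qed
  qed
  then show "chain_weight z \<notin> top_stratum n X x0"
    using Ri(2)[OF i(1)] by (auto simp: top_stratum_def)
qed

text \<open>In a nondegenerate representative the last member is the support, hence no complement.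
  The earlier members are proper subsets of a set of at most \<open>n\<close> points, so they are
  too small to be complements.\<close>

lemma subcomplex_representative:
  assumes x0: "x0 \<in> topspace X" and n: "n \<ge> 1"
    and R: "R = subtopology (exp_space n X) (topspace (exp_space n X) - exp_complements n X x0)"
    and z: "z \<in> topspace (realization_sum (chain_space (exp_space n X) (\<subseteq>)))"
    and L: "chain_weight z \<notin> top_stratum n X x0"
  obtains w where "w \<in> topspace (realization_sum (chain_space R (\<subseteq>)))"
    "order_complex_class (exp_space n X) (\<subseteq>) w = order_complex_class (exp_space n X) (\<subseteq>) z"
proof -
  let ?S = "realization_sum (chain_space (exp_space n X) (\<subseteq>))"
  obtain w where w: "w \<in> topspace ?S" "nondegenerate w"
    "equivclp (realization_rel (chain_space (exp_space n X) (\<subseteq>)) chain_face chain_degen) z w"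
    using nondegenerate_representative[of "fst z" "fst (snd z)" "snd (snd z)" "exp_space n X",
        unfolded prod.collapse, OF z] by blast
  obtain k A t where wk: "w = (k, A, t)"
    by (cases w)
  have A: "A \<in> {..k} \<rightarrow>\<^sub>E topspace (exp_space n X)" "\<forall>i<k. A i \<subset> A (Suc i)" "t \<in> standard_simplex k"
    and tk: "t k > 0" and weak: "\<forall>i<k. A i \<subseteq> A (Suc i)"
    using w(1,2) by (auto simp: wk topspace_realization_sum topspace_chain_space nondegenerate_def)
  have fin: "finite (A i)" "card (A i) \<le> n" if "i \<le> k" for i
    using A(1) that by (auto simp: topspace_exp_space PiE_iff)
  have eq: "chain_weight z = chain_weight w"
    using w(3) by (rule chain_weight_equivclp)
  have f: "chain_weight w \<in> fuzzy_sets n X"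
    using chain_weight_in_fuzzy_sets w(1) by (simp add: wk)
  have "{a. chain_weight w a \<noteq> 0} = A k"
  proof
    show "{a. chain_weight w a \<noteq> 0} \<subseteq> A k"
      unfolding wk using chain_weight_outside[OF weak] by blast
    have "t k \<le> chain_weight w a" if "a \<in> A k" for a
      using chain_weight_ge_tail[OF weak order_refl that, of t] A(3) by (simp add: wk standard_simplex_def)
    then show "A k \<subseteq> {a. chain_weight w a \<noteq> 0}"
      using tk by fastforce
  qed
  then have Ak: "x0 \<in> A k \<or> card (A k) < n"
    using L top_stratum_iff[OF f, of x0] unfolding eq by simp
  have "A i \<notin> exp_complements n X x0" if "i \<le> k" for i
  proof (cases "i = k")
    case True
    then show ?thesis using Ak by (auto simp: exp_complements_eq[OF x0 n])
  next
    case False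
    then have "A i \<subset> A k"
      using strict_chain_less[OF A(2) that order_refl] that by simp
    then have "card (A i) < n"
      using psubset_card_mono[OF fin(1)[OF order_refl], of "A i"] fin(2)[of k] by simp
    then show ?thesis by (simp add: exp_complements_eq[OF x0 n])
  qed
  then have "w \<in> topspace (realization_sum (chain_space R (\<subseteq>)))"
    using A(1,3) weak by (simp add: wk R topspace_realization_sum topspace_chain_space PiE_iff)
  moreover have "order_complex_class (exp_space n X) (\<subseteq>) w = order_complex_class (exp_space n X) (\<subseteq>) z"
    unfolding order_complex_class_def quotient_class_eq_iff[OF w(1) z] using w(3) by (rule equivclp_sym)
  ultimately show thesis by (rule that)
qed

theorem theorem5p8:
  fixes X :: "'a topology" and x0 :: 'a and n :: nat
  assumes "compact_space X" and "Hausdorff_space X"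
    and "x0 \<in> topspace X"
    and "n \<ge> 1"
    and "admissible n X x0"
  shows "order_complex (exp_space n X) (\<subseteq>)
           homotopy_equivalent_space thom_space n (subtopology X (topspace X - {x0}))"
proof -
  note X = assms(1,2) and x0 = assms(3) and n = assms(4)
  let ?P = "exp_space n X"
  define R where "R = subtopology ?P (topspace ?P - exp_complements n X x0)"
  let ?D = "order_complex ?P (\<subseteq>)" and ?A = "order_complex R (\<subseteq>)"
  let ?i = "order_complex_inclusion ?P (\<subseteq>)"
  let ?F = "fuzzy_space n X" and ?W = "top_stratum n X x0"
  let ?B = "thom_bundle n (subtopology X (topspace X - {x0}))"
  let ?Q = "Alexandroff_compactification ?B"
  have cof: "cofibration ?A ?D ?i"
    using assms(5) by (simp add: admissible_def Let_def R_def)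
  obtain e where e: "homeomorphic_map ?D ?F e"
    and ec: "\<And>z. z \<in> topspace (realization_sum (chain_space ?P (\<subseteq>))) \<Longrightarrow>
      e (order_complex_class ?P (\<subseteq>) z) = chain_weight z"
    and D: "compact_space ?D"
    using order_complex_homeomorphic_fuzzy_space[OF X n] by metis
  obtain e' where ee': "homeomorphic_maps ?D ?F e e'"
    using e homeomorphic_map_maps by blast
  have e_cont: "continuous_map ?D ?F e" and e'_cont: "continuous_map ?F ?D e'"
    and e'e: "\<And>c. c \<in> topspace ?D \<Longrightarrow> e' (e c) = c"
    and ee: "\<And>f. f \<in> fuzzy_sets n X \<Longrightarrow> e (e' f) = f"
    using ee' by (simp_all add: homeomorphic_maps_def)
  have e_surj: "e ` topspace ?D = fuzzy_sets n X"
    using homeomorphic_imp_surjective_map[OF e] by simp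
  have e_top: "e c \<in> fuzzy_sets n X" if "c \<in> topspace ?D" for c
    using e_surj that by blast
  have e'_top: "e' f \<in> topspace ?D" if "f \<in> fuzzy_sets n X" for f
    using continuous_map_image_subset_topspace[OF e'_cont] that by auto
  have F: "compact_space ?F"
    using D e homeomorphic_compact_space homeomorphic_map_imp_homeomorphic_space by blast
  have FH: "Hausdorff_space ?F"
    using X by (rule Hausdorff_fuzzy_space)
  have W: "openin ?F ?W"
    using X x0 n by (rule openin_top_stratum)
  obtain p where p: "homeomorphic_map (subtopology ?F ?W) ?B p"
    using top_stratum_homeomorphic_thom_bundle[OF X x0 n] .
  let ?c = "\<lambda>f. if f \<in> ?W then Some (p f) else None"
  have c: "continuous_map ?F ?Q ?c"
    using FH W p by (rule continuous_map_to_Alexandroff)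
  have topW: "topspace (subtopology ?F ?W) = ?W"
    using top_stratum_subset by fastforce
  have pW: "p ` ?W = topspace ?B" and p_inj: "inj_on p ?W"
    using homeomorphic_imp_surjective_map[OF p] homeomorphic_imp_injective_map[OF p] unfolding topW by simp_all
  have A_class: "\<exists>z \<in> topspace (realization_sum (chain_space R (\<subseteq>))). a = order_complex_class R (\<subseteq>) z"
    if "a \<in> topspace ?A" for a
    using that quotient_imp_surjective_map[OF quotient_map_order_complex_class[of R "(\<subseteq>)"]] by blast
  \<comment> \<open>As a set, the image of the subcomplex is the preimage of the complement of the
    top stratum.\<close>
  have iA: "?i ` topspace ?A = {c \<in> topspace ?D. e c \<notin> ?W}"
  proof (intro equalityI subsetI)
    fix c assume "c \<in> ?i ` topspace ?A"
    then obtain z where z: "z \<in> topspace (realization_sum (chain_space R (\<subseteq>)))"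
      "c = ?i (order_complex_class R (\<subseteq>) z)"
      using A_class by blast
    have c: "c = order_complex_class ?P (\<subseteq>) z"
      unfolding z(2) R_def using z(1) by (intro order_complex_inclusion_class) (simp add: R_def)
    note zP = chain_weight_subcomplex[OF x0 n R_def z(1)]
    have "c \<in> topspace ?D"
      unfolding c using quotient_imp_surjective_map[OF quotient_map_order_complex_class] zP(1) by blast
    then show "c \<in> {c \<in> topspace ?D. e c \<notin> ?W}"
      using zP(2) ec[OF zP(1)] c by simp
  next
    fix c assume "c \<in> {c \<in> topspace ?D. e c \<notin> ?W}"
    then have c: "c \<in> topspace ?D" "e c \<notin> ?W" by simp_all
    then obtain z where z: "z \<in> topspace (realization_sum (chain_space ?P (\<subseteq>)))" "c = order_complex_class ?P (\<subseteq>) z"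
      using quotient_imp_surjective_map[OF quotient_map_order_complex_class[of ?P "(\<subseteq>)"]] by blast
    have "chain_weight z \<notin> ?W"
      using c(2) ec[OF z(1)] z(2) by simp
    then obtain w where w: "w \<in> topspace (realization_sum (chain_space R (\<subseteq>)))"
      "order_complex_class ?P (\<subseteq>) w = order_complex_class ?P (\<subseteq>) z"
      using subcomplex_representative[OF x0 n R_def z(1)] by blast
    have "?i (order_complex_class R (\<subseteq>) w) = c"
      unfolding z(2) w(2)[symmetric] R_def using w(1) by (intro order_complex_inclusion_class) (simp add: R_def)
    moreover have "order_complex_class R (\<subseteq>) w \<in> topspace ?A"
      using quotient_imp_surjective_map[OF quotient_map_order_complex_class] w(1) by blast
    ultimately show "c \<in> ?i ` topspace ?A" by blast
  qed
  let ?L = "{f \<in> fuzzy_sets n X. f \<notin> ?W}"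
  have L: "x0 \<in> {a. f a \<noteq> 0} \<or> card {a. f a \<noteq> 0} < n" if "f \<in> ?L" for f
    using that top_stratum_iff[of f n X x0] by simp
  have cone: "cone_homotopy x0 (f, s) \<in> ?L" if "f \<in> ?L" "s \<in> {0..1}" for f s
  proof -
    have f: "f \<in> fuzzy_sets n X" using that(1) by simp
    note c = cone_homotopy_in_fuzzy_sets[OF f x0 n L[OF that(1)] that(2)]
    from c(1) show ?thesis
      using c(2) top_stratum_iff[OF c(1), of x0] by simp
  qed
  have ei: "e (?i a) \<in> ?L" if "a \<in> topspace ?A" for a
    using iA that e_top by blast
  \<comment> \<open>The contraction is carried out on fuzzy sets and brought back by
    \<open>e'\<close>; it depends on its source only through the continuous map
    \<open>e \<circ> ?i\<close>.\<close>
  define h where "h = (\<lambda>(a, s). e' (cone_homotopy x0 (e (?i a), s)))"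
  have h_cont: "continuous_map (prod_topology ?A (top_of_set {0..1})) ?D h"
  proof -
    have "continuous_map ?A ?D ?i"
      using cof by (simp add: cofibration_def)
    then have "continuous_map ?A ?F (e \<circ> ?i)"
      using e_cont by (rule continuous_map_compose)
    then have "continuous_map ?A (subtopology ?F ?L) (e \<circ> ?i)"
      unfolding continuous_map_in_subtopology using ei by (simp add: Pi_iff)
    then have "continuous_map (prod_topology ?A (top_of_set {0..1})) (prod_topology (subtopology ?F ?L) (top_of_set {0..1::real}))
        (\<lambda>(a, s). ((e \<circ> ?i) a, s))"
      by (simp add: continuous_map_prod_top o_def)
    moreover have "continuous_map (prod_topology (subtopology ?F ?L) (top_of_set {0..1})) ?D (e' \<circ> cone_homotopy x0)"
      using continuous_map_cone_homotopy[OF x0 n L] e'_cont by (rule continuous_map_compose)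
    ultimately have "continuous_map (prod_topology ?A (top_of_set {0..1})) ?D
        ((e' \<circ> cone_homotopy x0) \<circ> (\<lambda>(a, s). ((e \<circ> ?i) a, s)))"
      by (rule continuous_map_compose)
    moreover have "(e' \<circ> cone_homotopy x0) \<circ> (\<lambda>(a, s). ((e \<circ> ?i) a, s)) = h"
      by (simp add: h_def fun_eq_iff)
    ultimately show ?thesis by (simp only:)
  qed
  have "?D homotopy_equivalent_space ?Q"
  \<comment> \<open>The contraction ends at the vertex given by the singleton of \<open>x0\<close>,
    whose weight is the indicator of \<open>x0\<close>.\<close>
  proof (rule collapse_homotopy_equivalent[OF cof D, of ?Q "?c \<circ> e" h "e' (\<lambda>a. if a = x0 then 1 else 0)"])
    show "Hausdorff_space ?Q"
      using F FH W p by (rule Hausdorff_Alexandroff_open_subset)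
    show "continuous_map ?D ?Q (?c \<circ> e)"
      using e_cont c by (rule continuous_map_compose)
    \<comment> \<open>The indicator of \<open>x0\<close> is never in the top stratum, so infinity is
      attained even when the bundle is empty.\<close>
    have fx0: "(\<lambda>a. if a = x0 then 1 else 0) \<in> fuzzy_sets n X"
      using x0 n by (auto simp: fuzzy_sets_def topspace_exp_space)
    moreover have "(\<lambda>a. if a = x0 then 1 else 0) \<notin> ?W"
      by (simp add: top_stratum_def)
    ultimately have "None \<in> ?c ` fuzzy_sets n X"
      by (intro image_eqI[of _ _ "\<lambda>a. if a = x0 then 1 else 0"]) auto
    moreover have "Some ` topspace ?B \<subseteq> ?c ` fuzzy_sets n X"
      unfolding pW[symmetric] using top_stratum_subset[of n X x0] by force
    moreover have "?c ` fuzzy_sets n X \<subseteq> topspace ?Q"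
      using continuous_map_image_subset_topspace[OF c] by (simp only: topspace_fuzzy_space)
    ultimately show "(?c \<circ> e) ` topspace ?D = topspace ?Q"
      unfolding image_comp[symmetric] e_surj topspace_Alexandroff_compactification by (intro equalityI insert_subsetI)
  next
    fix x y assume xy: "x \<in> topspace ?D" "y \<in> topspace ?D" and eq: "(?c \<circ> e) x = (?c \<circ> e) y"
    show "x = y \<or> (x \<in> ?i ` topspace ?A \<and> y \<in> ?i ` topspace ?A)"
    proof (cases "e x \<in> ?W \<and> e y \<in> ?W")
      case True
      then have "e x = e y"
        using eq p_inj by (simp add: inj_on_eq_iff)
      then show ?thesis
        using e'e xy by metis
    next
      case False
      then have "e x \<notin> ?W" "e y \<notin> ?W"
        using eq by (auto split: if_splits)
      then show ?thesis
        unfolding iA using xy by simp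
    qed
  next
    show "(?c \<circ> e) (?i a) = (?c \<circ> e) (?i b)" if "a \<in> topspace ?A" "b \<in> topspace ?A" for a b
      using ei[OF that(1)] ei[OF that(2)] by simp
  next
    show "continuous_map (prod_topology ?A (top_of_set {0..1})) ?D h"
      by (rule h_cont)
  next
    fix a assume a: "a \<in> topspace ?A"
    have "?i a \<in> topspace ?D" "e (?i a) \<in> fuzzy_sets n X"
      using iA a ei[OF a] by blast+
    then show "h (a, 0) = ?i a"
      by (simp add: h_def cone_homotopy_0 e'e)
    show "h (a, 1) = e' (\<lambda>a. if a = x0 then 1 else 0)"
      by (simp add: h_def cone_homotopy_1)
    fix s :: real assume s: "s \<in> {0..1}"
    have "cone_homotopy x0 (e (?i a), s) \<in> ?L"
      using ei[OF a] s by (rule cone)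
    then show "h (a, s) \<in> ?i ` topspace ?A"
      unfolding iA h_def using e'_top ee by simp
  qed
  then show ?thesis
    by (simp add: thom_space_def)
qed

end
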